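(* Let $L$ be the set of limiting densities of minor-closed families of simple graphs (with finite limiting density). Then $$L\cap(-\infty,3/2)=\Big\{\tfrac{i}{i+1}: i\ge 0\Big\}\cup\Big\{\tfrac{3i}{2i+1}: i\ge1\Big\}\cup\Big\{\tfrac{3i+2}{2i+2}: i\ge1\Big\}\cup\Big\{\tfrac{3i+4}{2i+3}: i\ge1\Big\},$$ where $i$ ranges over integers. Moreover, for all integers $i\ge1$ and $j\ge1$, the number $i+(j-1)/j$ is an order-$i$ cluster point of $L$.
   Context: All graphs are finite simple graphs. A minor of a graph $G$ is a simple graph obtained from $G$ by a sequence of edge contractions (merging resulting parallel edges and deleting resulting loops), edge deletions and vertex deletions. A family $\mathcal{F}$ is minor-closed if every minor of a graph in $\mathcal{F}$ belongs to $\mathcal{F}$. For such $\mathcal{F}$, with $\mathrm{ex}_{\mathcal{F}}(n)$ the maximum number of edges of an $n$-vertex graph in $\mathcal{F}$ ($0$ if none), the limiting density is $\limsup_{n\to\infty}\mathrm{ex}_{\mathcal{F}}(n)/n$. A point $x$ is an order-$1$ cluster point of $L$ if it is a cluster point of $L$ (every neighbourhood of $x$ contains a point of $L$ other than $x$); for $i\ge2$, $x$ is an order-$i$ cluster point of $L$ if it is a cluster point of the set of order-$(i-1)$ cluster points of $L$. *)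

theory Defs
  imports "HOL-Analysis.Analysis"
begin

text \<open>A graph is a pair of a vertex set and an edge set; an edge is a two-element set of vertices.\<close>

type_synonym 'v graph = "'v set \<times> 'v set set"

definition simple_graph :: "'v graph \<Rightarrow> bool" where
  "simple_graph G \<longleftrightarrow> finite (fst G) \<and> (\<forall>e\<in>snd G. e \<subseteq> fst G \<and> card e = 2)"

definition graph_iso :: "'v graph \<Rightarrow> 'w graph \<Rightarrow> bool" where
  "graph_iso G H \<longleftrightarrow> (\<exists>f. bij_betw f (fst G) (fst H) \<and> snd H = (\<lambda>e. f ` e) ` snd G)"

text \<open>
  The vertex arising from the contraction of the edge \<open>uv\<close> keeps the name \<open>u\<close>. Parallel edges are
  merged because edges form a set; the condition \<open>card e = 2\<close> deletes the loop.
\<close>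

definition contract_edge :: "'v \<Rightarrow> 'v \<Rightarrow> 'v graph \<Rightarrow> 'v graph" where
  "contract_edge u v G =
     (fst G - {v}, {e \<in> (\<lambda>d. (\<lambda>x. if x = v then u else x) ` d) ` snd G. card e = 2})"

inductive minor_step :: "'v graph \<Rightarrow> 'v graph \<Rightarrow> bool" where
  contraction: "{u, v} \<in> snd G \<Longrightarrow> u \<noteq> v \<Longrightarrow> minor_step G (contract_edge u v G)"
| edge_deletion: "e \<in> snd G \<Longrightarrow> minor_step G (fst G, snd G - {e})"
| vertex_deletion: "v \<in> fst G \<Longrightarrow> minor_step G (fst G - {v}, {e \<in> snd G. v \<notin> e})"

text \<open>Minors are taken up to isomorphism, so that minor-closed families are closed under isomorphism.\<close>

definition is_minor :: "'w graph \<Rightarrow> 'v graph \<Rightarrow> bool" where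
  "is_minor H G \<longleftrightarrow> (\<exists>K. minor_step\<^sup>*\<^sup>* G K \<and> graph_iso K H)"

text \<open>Every finite graph is isomorphic to one whose vertices are natural numbers.\<close>

definition minor_closed :: "nat graph set \<Rightarrow> bool" where
  "minor_closed \<F> \<longleftrightarrow>
     (\<forall>G\<in>\<F>. simple_graph G) \<and> (\<forall>G\<in>\<F>. \<forall>H :: nat graph. is_minor H G \<longrightarrow> H \<in> \<F>)"

definition max_edges :: "nat graph set \<Rightarrow> nat \<Rightarrow> nat" where
  "max_edges \<F> n =
     (if \<exists>G\<in>\<F>. card (fst G) = n then Max {card (snd G) | G. G \<in> \<F> \<and> card (fst G) = n} else 0)"

lemma finite_edge_counts:
  assumes "\<forall>G\<in>\<F>. simple_graph G"
  shows "finite {card (snd G) | G. G \<in> \<F> \<and> card (fst G) = n}"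
proof (rule finite_subset[OF _ finite_atMost[of "2 ^ n"]], safe)
  fix G assume "G \<in> \<F>" "n = card (fst G)"
  then have "finite (fst G)" "snd G \<subseteq> Pow (fst G)"
    using assms by (auto simp: simple_graph_def)
  then show "card (snd G) \<le> 2 ^ card (fst G)"
    by (metis card_Pow card_mono finite_Pow_iff)
qed

definition limiting_density :: "nat graph set \<Rightarrow> ereal" where
  "limiting_density \<F> = limsup (\<lambda>n. ereal (real (max_edges \<F> n) / real n))"

definition limiting_densities :: "real set" where
  "limiting_densities = {x. \<exists>\<F>. minor_closed \<F> \<and> limiting_density \<F> = ereal x}"

text \<open>The order-\<open>i\<close> cluster points for \<open>i \<ge> 1\<close>; order \<open>0\<close> is \<open>S\<close> itself, by convention.\<close>

primrec cluster_points :: "nat \<Rightarrow> 'a::topological_space set \<Rightarrow> 'a set" where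
  "cluster_points 0 S = S"
| "cluster_points (Suc i) S = {x. x islimpt cluster_points i S}"

end

theory Submission
  imports Defs
begin

text \<open>
  \<^bold>\<open>Upper half.\<close> Let \<open>\<F>\<close> have limiting density \<open>x\<close> with \<open>1 \<le> x < 3/2\<close>, and suppose that \<open>a < x < b\<close> where
  no listed value lies strictly between \<open>a\<close> and \<open>b\<close>. In a vertex-minimal \<open>G \<in> \<F>\<close> with \<open>e(G) > a v(G) + C\<close> every
  edge lies in a triangle, since contracting any other edge loses one vertex and one edge. Growing a
  vertex set by triangles yields sets \<open>S\<close> that no edge leaves and that satisfy \<open>2 e(S) \<ge> 3 (|S| - 1)\<close>;
  the quotients \<open>e(S)/|S| < 3/2\<close> of this kind are exactly the listed values from \<open>1\<close> on. So the vertex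
  set splits into parts of density at most \<open>a\<close> and parts of density at least \<open>b\<close>. The union of
  the latter is bounded because the limiting density is below \<open>b\<close>, a contradiction for large \<open>C\<close>.
  Below \<open>1\<close> the same splitting works with \<open>e(S) \<ge> |S| - 1\<close> and without minimality.

  \<^bold>\<open>Lower half.\<close> If a minor-closed family has at most \<open>d v\<close> edges, with equality for \<open>n\<close> vertices,
  then disjoint unions of graphs on at most \<open>n + 1\<close> vertices that lie in the family after the removal of one
  apex have at most \<open>d' v\<close> edges for \<open>d' = (d + 1) n / (n + 1)\<close>, and this is attained. Starting with edgeless
  graphs this gives \<open>i/(i + 1)\<close>, and since \<open>d'\<close> tends to \<open>d + 1\<close>, iteration gives the cluster points. The other
  three sequences arise in the same way from forests obtained from a matching by adding at
  most two pendant edges.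
\<close>

section \<open>Induced edges, and closure properties of minor-closed families\<close>

definition edges_in :: "'v set set \<Rightarrow> 'v set \<Rightarrow> 'v set set" where
  "edges_in E S = {e \<in> E. e \<subseteq> S}"

text \<open>For a set of vertices this means a union of connected components. Phrased through edges,
  it requires neither paths nor components.\<close>

definition separated :: "'v set set \<Rightarrow> 'v set \<Rightarrow> bool" where
  "separated E S \<longleftrightarrow> (\<forall>e\<in>E. e \<subseteq> S \<or> e \<inter> S = {})"

lemma simple_graph_finite_edges:
  assumes "simple_graph G"
  shows "finite (snd G)"
proof -
  have "snd G \<subseteq> Pow (fst G)" "finite (fst G)"
    using assms by (auto simp: simple_graph_def)
  then show ?thesis by (metis finite_Pow_iff finite_subset)
qed

lemma finite_edges_in [simp]: "finite E \<Longrightarrow> finite (edges_in E S)"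
  by (simp add: edges_in_def)

lemma graph_iso_refl: "graph_iso G G"
  unfolding graph_iso_def by (rule exI[of _ id]) auto

text \<open>A minor is reached by single steps followed by one isomorphism, so the steps can be
  handled by induction and the isomorphism once at the end.\<close>

lemma minor_closedI:
  assumes "\<And>G. G \<in> \<F> \<Longrightarrow> simple_graph G"
    and step: "\<And>G H. G \<in> \<F> \<Longrightarrow> minor_step G H \<Longrightarrow> H \<in> \<F>"
    and iso: "\<And>G H. G \<in> \<F> \<Longrightarrow> graph_iso G H \<Longrightarrow> H \<in> \<F>"
  shows "minor_closed \<F>"
proof -
  have "K \<in> \<F>" if "minor_step\<^sup>*\<^sup>* G K" "G \<in> \<F>" for G K
    using that by (induction rule: rtranclp_induct) (auto intro: step)
  then show ?thesis
    using assms(1) iso unfolding minor_closed_def is_minor_def by blast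
qed

lemma minor_closed_simple: "minor_closed \<F> \<Longrightarrow> G \<in> \<F> \<Longrightarrow> simple_graph G"
  by (simp add: minor_closed_def)

lemma minor_closed_step:
  assumes "minor_closed \<F>" "G \<in> \<F>" "minor_step G H"
  shows "H \<in> \<F>"
proof -
  have "is_minor H G"
    using assms(3) graph_iso_refl unfolding is_minor_def by blast
  then show ?thesis using assms(1,2) unfolding minor_closed_def by blast
qed

lemma minor_closed_iso:
  assumes "minor_closed \<F>" "G \<in> \<F>" "graph_iso G H"
  shows "H \<in> \<F>"
proof -
  have "is_minor H G"
    using assms(3) unfolding is_minor_def by blast
  then show ?thesis using assms(1,2) unfolding minor_closed_def by blast
qed

lemma minor_closed_delete_vertices:
  assumes "minor_closed \<F>" "(V, E) \<in> \<F>" "finite D" "D \<subseteq> V"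
  shows "(V - D, {e \<in> E. e \<inter> D = {}}) \<in> \<F>"
  using assms(3,4)
proof (induction D rule: finite_induct)
  case empty
  then show ?case using assms(2) by simp
next
  case (insert x D)
  have "minor_step (V - D, {e \<in> E. e \<inter> D = {}})
      (V - D - {x}, {e \<in> {e \<in> E. e \<inter> D = {}}. x \<notin> e})"
    using vertex_deletion[of x "(V - D, {e \<in> E. e \<inter> D = {}})"] insert by simp
  moreover have "V - D - {x} = V - insert x D"
    "{e \<in> {e \<in> E. e \<inter> D = {}}. x \<notin> e} = {e \<in> E. e \<inter> insert x D = {}}"
    by auto
  ultimately show ?case
    using insert minor_closed_step[OF assms(1)] by auto
qed

lemma minor_closed_delete_edges:
  assumes "minor_closed \<F>" "(V, E) \<in> \<F>" "finite D" "D \<subseteq> E"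
  shows "(V, E - D) \<in> \<F>"
  using assms(3,4)
proof (induction D rule: finite_induct)
  case empty
  then show ?case using assms(2) by simp
next
  case (insert x D)
  have "minor_step (V, E - D) (V, E - D - {x})"
    using edge_deletion[of x "(V, E - D)"] insert by simp
  moreover have "E - D - {x} = E - insert x D" by auto
  ultimately show ?case
    using insert minor_closed_step[OF assms(1)] by auto
qed

text \<open>Delete the vertices outside \<open>V'\<close> first, then the surviving edges outside
  \<open>E'\<close>.\<close>

lemma minor_closed_subgraph:
  assumes "minor_closed \<F>" "(V, E) \<in> \<F>" "V' \<subseteq> V" "E' \<subseteq> E" "\<And>e. e \<in> E' \<Longrightarrow> e \<subseteq> V'"
  shows "(V', E') \<in> \<F>"
proof -
  have s: "simple_graph (V, E)" by (rule minor_closed_simple[OF assms(1,2)])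
  let ?E = "{e \<in> E. e \<inter> (V - V') = {}}"
  have "finite (V - V')" "finite E"
    using s simple_graph_finite_edges[OF s] by (auto simp: simple_graph_def)
  then have "(V - (V - V'), ?E) \<in> \<F>"
    using minor_closed_delete_vertices[OF assms(1,2), of "V - V'"] by auto
  moreover have "V - (V - V') = V'" using assms(3) by auto
  ultimately have "(V', ?E) \<in> \<F>" by simp
  then have "(V', ?E - (?E - E')) \<in> \<F>"
    using \<open>finite E\<close> by (intro minor_closed_delete_edges[OF assms(1)]) auto
  moreover have "?E - (?E - E') = E'" using assms(4,5) by auto
  ultimately show ?thesis by simp
qed

section \<open>Edge maxima and bounds for the limiting density\<close>

lemma card_edges_le_max_edges:
  assumes "minor_closed \<F>" "G \<in> \<F>"
  shows "card (snd G) \<le> max_edges \<F> (card (fst G))"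
proof -
  have "card (snd G) \<le> Max {card (snd H) | H. H \<in> \<F> \<and> card (fst H) = card (fst G)}"
  proof (rule Max_ge)
    show "card (snd G) \<in> {card (snd H) | H. H \<in> \<F> \<and> card (fst H) = card (fst G)}"
      using assms(2) by blast
  qed (use assms(1) minor_closed_def in \<open>blast intro: finite_edge_counts\<close>)
  then show ?thesis using assms(2) by (auto simp: max_edges_def)
qed

text \<open>The condition \<open>0 \<le> B\<close> covers the default value \<open>0\<close> of
  \<open>max_edges\<close> at those \<open>n\<close> for which the family has no
  \<open>n\<close>-vertex graph.\<close>

lemma max_edges_le:
  assumes "minor_closed \<F>" "0 \<le> B"
    and "\<And>G. G \<in> \<F> \<Longrightarrow> card (fst G) = n \<Longrightarrow> real (card (snd G)) \<le> B"
  shows "real (max_edges \<F> n) \<le> B"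
proof (cases "\<exists>G\<in>\<F>. card (fst G) = n")
  case True
  let ?S = "{card (snd G) | G. G \<in> \<F> \<and> card (fst G) = n}"
  have "Max ?S \<in> ?S"
    using True assms(1) by (intro Max_in finite_edge_counts) (auto simp: minor_closed_def)
  then show ?thesis using True assms(3) by (auto simp: max_edges_def)
next
  case False
  then show ?thesis using assms(2) by (simp add: max_edges_def)
qed

lemma limiting_density_nonneg: "0 \<le> limiting_density \<F>"
  unfolding limiting_density_def
  by (intro le_Limsup always_eventually) auto

text \<open>The additive constant disappears in the limit after division by
  \<open>n\<close>.\<close>

lemma limiting_density_le:
  assumes "minor_closed \<F>" "0 \<le> a" "0 \<le> C"
    and "\<And>G. G \<in> \<F> \<Longrightarrow> real (card (snd G)) \<le> a * real (card (fst G)) + C"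
  shows "limiting_density \<F> \<le> ereal a"
proof -
  have le: "real (max_edges \<F> n) \<le> a * real n + C" for n
    using assms by (intro max_edges_le) auto
  have "(\<lambda>n. a + C * inverse (real n)) \<longlonglongrightarrow> a + C * 0"
    by (intro tendsto_intros LIMSEQ_inverse_real_of_nat[THEN LIMSEQ_imp_Suc])
  then have lim: "limsup (\<lambda>n. ereal (a + C * inverse (real n))) = ereal a"
    by (intro lim_imp_Limsup) auto
  have "limiting_density \<F> \<le> limsup (\<lambda>n. ereal (a + C * inverse (real n)))"
    unfolding limiting_density_def
  proof (rule Limsup_mono)
    show "\<forall>\<^sub>F n in sequentially. ereal (real (max_edges \<F> n) / real n)
        \<le> ereal (a + C * inverse (real n))"
      using eventually_gt_at_top[of "0::nat"]
      by eventually_elim (use le in \<open>auto simp: field_simps\<close>)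
  qed
  then show ?thesis using lim by simp
qed

text \<open>Extremal graphs at the multiples of \<open>q\<close> suffice, because the limsup along a
  subsequence bounds the limsup from below.\<close>

lemma limiting_density_eq:
  assumes "minor_closed \<F>" "0 \<le> d" "0 < q"
    and upper: "\<And>G. G \<in> \<F> \<Longrightarrow> real (card (snd G)) \<le> d * real (card (fst G))"
    and lower: "\<And>m. \<exists>G\<in>\<F>. card (fst G) = m * q \<and> real (card (snd G)) = d * real (m * q)"
  shows "limiting_density \<F> = ereal d"
proof (rule antisym)
  show "limiting_density \<F> \<le> ereal d"
    using limiting_density_le[of \<F> d 0] assms by auto
  let ?X = "\<lambda>n. ereal (real (max_edges \<F> n) / real n)"
  \<comment> \<open>\<open>Suc m\<close> instead of \<open>m\<close> avoids order \<open>0\<close>,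
    where the quotient is \<open>0\<close> by the convention for division by zero.\<close>
  let ?r = "\<lambda>m. Suc m * q"
  have "ereal d \<le> (?X \<circ> ?r) m" for m
  proof -
    obtain G where "G \<in> \<F>" "card (fst G) = ?r m" "real (card (snd G)) = d * real (?r m)"
      using lower by blast
    then have "d * real (?r m) \<le> real (max_edges \<F> (?r m))"
      using card_edges_le_max_edges[OF assms(1)] by (metis of_nat_le_iff)
    moreover have "0 < real (?r m)" using \<open>0 < q\<close> by (simp del: mult_Suc)
    ultimately show ?thesis
      unfolding comp_def ereal_less_eq(3) by (subst pos_le_divide_eq) auto
  qed
  then have "ereal d \<le> limsup (?X \<circ> ?r)"
    by (intro le_Limsup always_eventually) auto
  also have "\<dots> \<le> limsup ?X"
    using \<open>0 < q\<close> by (intro limsup_subseq_mono strict_monoI) simp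
  finally show "ereal d \<le> limiting_density \<F>"
    by (simp add: limiting_density_def)
qed

section \<open>Splitting a graph along vertex sets that no edge leaves\<close>

lemma edge_obtain:
  assumes "simple_graph (V, E)" "e \<in> E"
  obtains x y where "e = {x, y}" "x \<noteq> y" "x \<in> V" "y \<in> V"
proof -
  have "card e = 2" "e \<subseteq> V" using assms by (auto simp: simple_graph_def)
  then show ?thesis using that unfolding card_2_iff by blast
qed

lemma separated_Diff:
  assumes "separated E W" "separated E S"
  shows "separated E (W - S)"
  unfolding separated_def
proof
  fix e assume "e \<in> E"
  then have "e \<subseteq> W \<or> e \<inter> W = {}" "e \<subseteq> S \<or> e \<inter> S = {}"
    using assms by (simp_all add: separated_def)
  then show "e \<subseteq> W - S \<or> e \<inter> (W - S) = {}" by auto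
qed

lemma separated_Un:
  assumes "separated E W" "separated E S"
  shows "separated E (W \<union> S)"
  unfolding separated_def
proof
  fix e assume "e \<in> E"
  then have "e \<subseteq> W \<or> e \<inter> W = {}" "e \<subseteq> S \<or> e \<inter> S = {}"
    using assms by (simp_all add: separated_def)
  then show "e \<subseteq> W \<union> S \<or> e \<inter> (W \<union> S) = {}" by auto
qed

lemma separated_edge:
  assumes "separated E W" "{x, y} \<in> E" "x \<in> W"
  shows "y \<in> W"
  using bspec[OF assms(1)[unfolded separated_def] assms(2)] assms(3) by auto

text \<open>No edge joins \<open>A\<close> to \<open>S\<close> because \<open>S\<close> is
  separated. Nonemptiness of edges ensures that none is counted on both sides.\<close>

lemma card_edges_in_Un:
  assumes "finite E" "\<And>e. e \<in> E \<Longrightarrow> e \<noteq> {}" "separated E S" "A \<inter> S = {}"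
  shows "card (edges_in E (A \<union> S)) = card (edges_in E A) + card (edges_in E S)"
proof -
  have "edges_in E (A \<union> S) = edges_in E A \<union> edges_in E S"
    using assms(3) by (fastforce simp: edges_in_def separated_def)
  moreover have "edges_in E A \<inter> edges_in E S = {}"
    using assms(2,4) by (fastforce simp: edges_in_def)
  ultimately show ?thesis using assms(1) by (simp add: card_Un_disjoint)
qed

text \<open>Induction on \<open>W\<close>: remove one piece \<open>S\<close>, split the rest, and
  attach \<open>S\<close> to the sparse side \<open>A\<close> or to the dense side \<open>B\<close>.
  Both inequalities are additive over separated disjoint sets.\<close>

lemma separated_split:
  fixes a b :: real
  assumes fin: "finite V" "finite E" and ne: "\<And>e. e \<in> E \<Longrightarrow> e \<noteq> {}"
    and piece: "\<And>W. W \<subseteq> V \<Longrightarrow> W \<noteq> {} \<Longrightarrow> separated E W \<Longrightarrow>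
      \<exists>S\<subseteq>W. S \<noteq> {} \<and> separated E S \<and>
        (real (card (edges_in E S)) \<le> a * real (card S)
         \<or> b * real (card S) \<le> real (card (edges_in E S)))"
    and W: "W \<subseteq> V" "separated E W"
  shows "\<exists>A B. A \<inter> B = {} \<and> A \<union> B = W \<and> separated E A \<and> separated E B \<and>
    real (card (edges_in E A)) \<le> a * real (card A) \<and>
    b * real (card B) \<le> real (card (edges_in E B))"
proof -
  have "finite W" using W(1) fin(1) by (rule finite_subset)
  then show ?thesis using W
  proof (induction W rule: finite_psubset_induct)
    case (psubset W)
    show ?case
    proof (cases "W = {}")
      case True
      have "edges_in E {} = {}" using ne by (auto simp: edges_in_def)
      then show ?thesis using True by (auto simp: separated_def)
    next
      case False
      then obtain S where S: "S \<subseteq> W" "S \<noteq> {}" "separated E S"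
        and cases: "real (card (edges_in E S)) \<le> a * real (card S)
          \<or> b * real (card S) \<le> real (card (edges_in E S))"
        using piece psubset.prems by blast
      have "W - S \<subset> W" using S by blast
      moreover have "separated E (W - S)" using separated_Diff psubset.prems(2) S(3) by blast
      ultimately obtain A B where AB: "A \<inter> B = {}" "A \<union> B = W - S" "separated E A" "separated E B"
        "real (card (edges_in E A)) \<le> a * real (card A)"
        "b * real (card B) \<le> real (card (edges_in E B))"
        using psubset.IH[of "W - S"] psubset.prems(1) by blast
      have fS: "finite S" "finite A" "finite B"
        using AB(2) S(1) psubset.hyps by (auto intro: finite_subset[of _ W])
      have disj: "A \<inter> S = {}" "B \<inter> S = {}" using AB(2) by auto
      have cardS: "card (A \<union> S) = card A + card S" "card (B \<union> S) = card B + card S"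
        using fS disj by (auto intro: card_Un_disjoint)
      have edS: "card (edges_in E (A \<union> S)) = card (edges_in E A) + card (edges_in E S)"
        "card (edges_in E (B \<union> S)) = card (edges_in E B) + card (edges_in E S)"
        using card_edges_in_Un[OF fin(2) ne S(3)] disj by auto
      from cases show ?thesis
      proof
        assume "real (card (edges_in E S)) \<le> a * real (card S)"
        then have "real (card (edges_in E (A \<union> S))) \<le> a * real (card (A \<union> S))"
          using AB(5) cardS edS by (simp add: algebra_simps)
        moreover have "(A \<union> S) \<inter> B = {}" "(A \<union> S) \<union> B = W" using AB disj S(1) by auto
        ultimately show ?thesis using AB separated_Un[OF AB(3) S(3)] by blast
      next
        assume "b * real (card S) \<le> real (card (edges_in E S))"
        then have "b * real (card (B \<union> S)) \<le> real (card (edges_in E (B \<union> S)))"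
          using AB(6) cardS edS by (simp add: algebra_simps)
        moreover have "A \<inter> (B \<union> S) = {}" "A \<union> (B \<union> S) = W" using AB disj S(1) by auto
        ultimately show ?thesis using AB separated_Un[OF AB(4) S(3)] by blast
      qed
    qed
  qed
qed

text \<open>From some order \<open>K\<close> on, every graph of the family has fewer than
  \<open>b n\<close> edges. A dense \<open>W\<close> of larger size would induce a subgraph in the
  family that violates this.\<close>

lemma dense_sets_bounded:
  assumes "minor_closed \<F>" "limiting_density \<F> < ereal b"
  obtains K where "\<And>V E W. (V, E) \<in> \<F> \<Longrightarrow> W \<subseteq> V \<Longrightarrow>
    b * real (card W) \<le> real (card (edges_in E W)) \<Longrightarrow> card W \<le> K"
proof -
  have "\<forall>\<^sub>F n in sequentially. ereal (real (max_edges \<F> n) / real n) < ereal b"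
    using assms(2) unfolding limiting_density_def by (rule Limsup_lessD)
  then obtain K where K: "\<And>n. n \<ge> K \<Longrightarrow> real (max_edges \<F> n) / real n < b"
    by (auto simp: eventually_sequentially)
  have "card W \<le> K"
    if G: "(V, E) \<in> \<F>" "W \<subseteq> V" "b * real (card W) \<le> real (card (edges_in E W))" for V E W
  proof (rule ccontr)
    assume "\<not> card W \<le> K"
    then have "real (max_edges \<F> (card W)) < b * real (card W)"
      using K[of "card W"] by (simp add: divide_less_eq)
    moreover have "(W, edges_in E W) \<in> \<F>"
      by (rule minor_closed_subgraph[OF assms(1) G(1,2)]) (auto simp: edges_in_def)
    ultimately show False
      using card_edges_le_max_edges[OF assms(1), of "(W, edges_in E W)"] G(3) by simp
  qed
  then show ?thesis by (rule that)
qed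

text \<open>The sparse side contributes at most \<open>a\<close> times its order. The dense side has
  at most \<open>K\<close> vertices, and the number of its subsets is a crude bound for its edges,
  uniform over the family.\<close>

lemma edge_bound_of_split:
  assumes s: "simple_graph (V, E)" and "0 \<le> a"
    and dense: "\<And>W. W \<subseteq> V \<Longrightarrow> b * real (card W) \<le> real (card (edges_in E W)) \<Longrightarrow> card W \<le> K"
    and piece: "\<And>W. W \<subseteq> V \<Longrightarrow> W \<noteq> {} \<Longrightarrow> separated E W \<Longrightarrow>
      \<exists>S\<subseteq>W. S \<noteq> {} \<and> separated E S \<and>
        (real (card (edges_in E S)) \<le> a * real (card S)
         \<or> b * real (card S) \<le> real (card (edges_in E S)))"
  shows "real (card E) \<le> a * real (card V) + 2 ^ K"
proof -
  have fin: "finite V" "finite E"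
    using s simple_graph_finite_edges[OF s] by (auto simp: simple_graph_def)
  have ne: "e \<noteq> {}" if "e \<in> E" for e
    using s that by (auto simp: simple_graph_def)
  have EV: "edges_in E V = E" "separated E V"
    using s by (auto simp: simple_graph_def edges_in_def separated_def)
  have "\<exists>A B. A \<inter> B = {} \<and> A \<union> B = V \<and> separated E A \<and> separated E B \<and>
    real (card (edges_in E A)) \<le> a * real (card A) \<and>
    b * real (card B) \<le> real (card (edges_in E B))"
    using piece by (intro separated_split[OF fin ne _ subset_refl EV(2)])
  then obtain A B where AB: "A \<inter> B = {}" "A \<union> B = V" "separated E B"
    "real (card (edges_in E A)) \<le> a * real (card A)" "b * real (card B) \<le> real (card (edges_in E B))"
    by blast
  have "finite B" using AB(2) fin(1) by auto
  have "card (edges_in E B) \<le> card (Pow B)"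
    using \<open>finite B\<close> by (intro card_mono) (auto simp: edges_in_def)
  also have "\<dots> \<le> 2 ^ K"
    using dense[of B] AB \<open>finite B\<close> by (auto simp: card_Pow intro: power_increasing)
  finally have "real (card (edges_in E B)) \<le> 2 ^ K"
    by (metis numeral_power_le_of_nat_cancel_iff of_nat_le_iff of_nat_numeral of_nat_power)
  moreover have "real (card E) = real (card (edges_in E A)) + real (card (edges_in E B))"
    using card_edges_in_Un[OF fin(2) ne AB(3,1)] EV AB(2) by simp
  moreover have "a * real (card A) \<le> a * real (card V)"
    using AB(2) fin(1) \<open>0 \<le> a\<close> by (intro mult_left_mono) (auto intro: card_mono)
  ultimately show ?thesis using AB(4) by linarith
qed

section \<open>Growing a vertex set until no edge leaves it\<close>

text \<open>An inclusion-maximal nonempty subset of \<open>W\<close> with property \<open>Q\<close>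
  exists by finiteness, starting from the singleton. If an edge left it, \<open>grow\<close> would
  enlarge it.\<close>

lemma grow_to_separated:
  assumes "finite W" "x \<in> W" "Q {x}"
    and grow: "\<And>S. S \<subseteq> W \<Longrightarrow> Q S \<Longrightarrow> \<not> separated E S \<Longrightarrow> \<exists>S'\<subseteq>W. S \<subset> S' \<and> Q S'"
  shows "\<exists>S\<subseteq>W. S \<noteq> {} \<and> separated E S \<and> Q S"
proof -
  let ?C = "{S. S \<subseteq> W \<and> S \<noteq> {} \<and> Q S}"
  have "{x} \<in> ?C" using assms(2,3) by simp
  then have "?C \<noteq> {}" by (metis empty_iff)
  moreover have "finite ?C" using assms(1) by simp
  ultimately have "\<exists>S\<in>?C. \<forall>S'\<in>?C. S \<subseteq> S' \<longrightarrow> S = S'"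
    by (intro finite_has_maximal)
  then obtain S where S: "S \<subseteq> W" "S \<noteq> {}" "Q S"
    and max: "\<And>S'. S' \<in> ?C \<Longrightarrow> S \<subseteq> S' \<Longrightarrow> S = S'"
    by auto
  have "separated E S"
  proof (rule ccontr)
    assume "\<not> separated E S"
    then obtain S' where "S' \<subseteq> W" "S \<subset> S'" "Q S'" using grow[OF S(1,3)] by auto
    then show False using max[of S'] S(2) by auto
  qed
  then show ?thesis using S by auto
qed

lemma not_separated_edge:
  assumes "simple_graph (V, E)" "\<not> separated E S"
  obtains s t where "{s, t} \<in> E" "s \<in> S" "t \<notin> S"
proof -
  obtain e where "e \<in> E" "\<not> e \<subseteq> S" "e \<inter> S \<noteq> {}"
    using assms(2) by (auto simp: separated_def)
  moreover obtain x y where "e = {x, y}"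
    using edge_obtain[OF assms(1) \<open>e \<in> E\<close>] by metis
  ultimately show ?thesis using that[of x y] that[of y x] by (auto simp: insert_commute)
qed

text \<open>Crossing an edge that leaves \<open>S\<close> adds one vertex and at least one edge, as
  in the growth of a spanning tree.\<close>

lemma tree_piece:
  assumes s: "simple_graph (V, E)" and W: "W \<subseteq> V" "W \<noteq> {}" "separated E W"
  shows "\<exists>S\<subseteq>W. S \<noteq> {} \<and> separated E S \<and> card S \<le> card (edges_in E S) + 1"
proof -
  have fin: "finite W" "finite E"
    using s simple_graph_finite_edges[OF s] W(1) by (auto simp: simple_graph_def intro: finite_subset)
  obtain x where "x \<in> W" using W(2) by blast
  then show ?thesis
  proof (rule grow_to_separated[OF fin(1)])
    fix S assume S: "S \<subseteq> W" "card S \<le> card (edges_in E S) + 1" "\<not> separated E S"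
    obtain p t where st: "{p, t} \<in> E" "p \<in> S" "t \<notin> S"
      using not_separated_edge[OF s S(3)] by blast
    have "t \<in> W" using separated_edge[OF W(3) st(1)] st(2) S(1) by blast
    have "card (insert {p, t} (edges_in E S)) \<le> card (edges_in E (insert t S))"
      using st fin(2) by (intro card_mono) (auto simp: edges_in_def)
    moreover have "{p, t} \<notin> edges_in E S" using st by (auto simp: edges_in_def)
    ultimately have "card (insert t S) \<le> card (edges_in E (insert t S)) + 1"
      using S st(3) fin finite_subset[OF S(1) fin(1)] by simp
    then show "\<exists>S'\<subseteq>W. S \<subset> S' \<and> card S' \<le> card (edges_in E S') + 1"
      using S(1) \<open>t \<in> W\<close> st(3) by (intro exI[of _ "insert t S"]) auto
  qed simp
qed

text \<open>Let \<open>pt\<close> leave \<open>S\<close> and let \<open>ptw\<close> be a triangle.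
  If \<open>w\<close> is in \<open>S\<close>, one vertex and at least two edges are gained;
  otherwise two vertices and at least three edges. In neither case does
  \<open>3 |S| - 2 e(S)\<close> increase, and it is \<open>3\<close> for a single vertex.\<close>

lemma triangle_piece:
  assumes s: "simple_graph (V, E)" and W: "W \<subseteq> V" "W \<noteq> {}" "separated E W"
    and tri: "\<And>u v. {u, v} \<in> E \<Longrightarrow> \<exists>w. {u, w} \<in> E \<and> {v, w} \<in> E"
  shows "\<exists>S\<subseteq>W. S \<noteq> {} \<and> separated E S \<and> 3 * card S \<le> 2 * card (edges_in E S) + 3"
proof -
  have fin: "finite W" "finite E"
    using s simple_graph_finite_edges[OF s] W(1) by (auto simp: simple_graph_def intro: finite_subset)
  have ns: "x \<noteq> y" if "{x, y} \<in> E" for x y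
    using that s by (auto simp: simple_graph_def)
  obtain x where "x \<in> W" using W(2) by blast
  then show ?thesis
  proof (rule grow_to_separated[OF fin(1)])
    fix S assume S: "S \<subseteq> W" "3 * card S \<le> 2 * card (edges_in E S) + 3" "\<not> separated E S"
    have fS: "finite S" using S(1) fin(1) by (rule finite_subset)
    obtain p t where st: "{p, t} \<in> E" "p \<in> S" "t \<notin> S"
      using not_separated_edge[OF s S(3)] by blast
    obtain w where w: "{p, w} \<in> E" "{t, w} \<in> E" using tri[OF st(1)] by blast
    have in_W: "t \<in> W" "w \<in> W"
      using separated_edge[OF W(3) st(1)] separated_edge[OF W(3) w(1)] st(2) S(1) by blast+
    have d: "p \<noteq> t" "p \<noteq> w" "t \<noteq> w" using ns st w by auto
    show "\<exists>S'\<subseteq>W. S \<subset> S' \<and> 3 * card S' \<le> 2 * card (edges_in E S') + 3"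
    proof (cases "w \<in> S")
      case True
      have "card ({{p, t}, {t, w}} \<union> edges_in E S) \<le> card (edges_in E (insert t S))"
        using st w True fin(2) by (intro card_mono) (auto simp: edges_in_def)
      moreover have "{{p, t}, {t, w}} \<inter> edges_in E S = {}" using st by (auto simp: edges_in_def)
      moreover have "card {{p, t}, {t, w}} = 2" using d by (auto simp: card_2_iff doubleton_eq_iff)
      ultimately have "2 + card (edges_in E S) \<le> card (edges_in E (insert t S))"
        using fin(2) by (subst (asm) card_Un_disjoint) auto
      then have "3 * card (insert t S) \<le> 2 * card (edges_in E (insert t S)) + 3"
        using S(2) st(3) fS by simp
      then show ?thesis
        using S(1) in_W st(3) by (intro exI[of _ "insert t S"]) auto
    next
      case False
      let ?N = "{{p, t}, {p, w}, {t, w}}"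
      have "card (?N \<union> edges_in E S) \<le> card (edges_in E (insert t (insert w S)))"
        using st w fin(2) by (intro card_mono) (auto simp: edges_in_def)
      moreover have "?N \<inter> edges_in E S = {}" using st False by (auto simp: edges_in_def)
      moreover have "card ?N = 3" using d by (auto simp: card_insert_if doubleton_eq_iff)
      ultimately have "3 + card (edges_in E S) \<le> card (edges_in E (insert t (insert w S)))"
        using fin(2) by (subst (asm) card_Un_disjoint) auto
      then have "3 * card (insert t (insert w S)) \<le> 2 * card (edges_in E (insert t (insert w S))) + 3"
        using S(2) st(3) fS False d by simp
      then show ?thesis
        using S(1) in_W st(3) by (intro exI[of _ "insert t (insert w S)"]) auto
    qed
  qed simp
qed

section \<open>Contraction of an edge that lies in no triangle\<close>

text \<open>Two other edges can be merged only if they are \<open>uw\<close> and \<open>vw\<close>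
  for a common neighbour \<open>w\<close>, which would give a triangle on \<open>uv\<close>. So the
  edge map is injective away from \<open>uv\<close>, and it creates no loop there.\<close>

lemma card_contract_edge_ge:
  assumes s: "simple_graph (V, E)" and uv: "{u, v} \<in> E" "u \<noteq> v"
    and no_tri: "\<nexists>w. {u, w} \<in> E \<and> {v, w} \<in> E"
  shows "card E \<le> card (snd (contract_edge u v (V, E))) + 1"
proof -
  let ?\<phi> = "\<lambda>x. if x = v then u else x"
  let ?E' = "{e \<in> (\<lambda>d. ?\<phi> ` d) ` E. card e = 2}"
  have fE: "finite E" using simple_graph_finite_edges[OF s] by simp
  \<comment> \<open>Simplicity enters here: an edge at \<open>v\<close> other than \<open>uv\<close>
    has its second end \<open>w\<close> different from \<open>u\<close>, so its image
    \<open>uw\<close> is no loop.\<close>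
  have img: "(v \<notin> d \<and> ?\<phi> ` d = d) \<or> (\<exists>w. d = {v, w} \<and> w \<noteq> u \<and> w \<noteq> v \<and> ?\<phi> ` d = {u, w})"
    if d: "d \<in> E - {{u, v}}" for d
  proof (cases "v \<in> d")
    case True
    have "d \<in> E" using d by simp
    then obtain x y where "d = {x, y}" "x \<noteq> y" by (rule edge_obtain[OF s])
    then obtain w where w: "d = {v, w}" "w \<noteq> v" using True by blast
    have "w \<noteq> u"
    proof
      assume "w = u"
      then have "d = {u, v}" using w(1) by blast
      then show False using d by simp
    qed
    have "?\<phi> ` d = {u, w}" using w by (auto simp: insert_commute)
    then show ?thesis using w \<open>w \<noteq> u\<close> by (intro disjI2 exI[of _ w] conjI)
  next
    case False
    then have "?\<phi> ` d = id ` d" by (intro image_cong) auto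
    then show ?thesis using False by simp
  qed
  have "inj_on (\<lambda>d. ?\<phi> ` d) (E - {{u, v}})"
  proof (rule inj_onI)
    fix d d' assume dd: "d \<in> E - {{u, v}}" "d' \<in> E - {{u, v}}" "?\<phi> ` d = ?\<phi> ` d'"
    show "d = d'"
      using img[OF dd(1)] img[OF dd(2)]
    proof (elim disjE exE conjE)
      assume "?\<phi> ` d = d" "?\<phi> ` d' = d'" then show ?thesis using dd(3) by simp
    next
      fix w assume "?\<phi> ` d = d" "d' = {v, w}" "?\<phi> ` d' = {u, w}"
      then have "{u, w} \<in> E" "{v, w} \<in> E" using dd by auto
      then show ?thesis using no_tri by blast
    next
      fix w assume "?\<phi> ` d' = d'" "d = {v, w}" "?\<phi> ` d = {u, w}"
      then have "{u, w} \<in> E" "{v, w} \<in> E" using dd by auto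
      then show ?thesis using no_tri by blast
    next
      fix w w' assume "d = {v, w}" "?\<phi> ` d = {u, w}" "d' = {v, w'}" "?\<phi> ` d' = {u, w'}"
      then have "{u, w} = {u, w'}" "d = {v, w}" "d' = {v, w'}" using dd(3) by simp_all
      then show ?thesis by (auto simp: doubleton_eq_iff)
    qed
  qed
  then have "card (E - {{u, v}}) = card ((\<lambda>d. ?\<phi> ` d) ` (E - {{u, v}}))"
    by (simp add: card_image)
  also have "\<dots> \<le> card ?E'"
  proof (rule card_mono)
    show "finite ?E'" using fE by simp
    show "(\<lambda>d. ?\<phi> ` d) ` (E - {{u, v}}) \<subseteq> ?E'"
    proof
      fix e assume "e \<in> (\<lambda>d. ?\<phi> ` d) ` (E - {{u, v}})"
      then obtain d where d: "d \<in> E - {{u, v}}" "e = ?\<phi> ` d" by blast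
      have "card d = 2" using d(1) s by (auto simp: simple_graph_def)
      moreover have "card e = 2"
        using img[OF d(1)]
      proof (elim disjE exE conjE)
        assume "?\<phi> ` d = d"
        then show ?thesis using d(2) \<open>card d = 2\<close> by simp
      next
        fix w assume "w \<noteq> u" "?\<phi> ` d = {u, w}"
        then show ?thesis using d(2) by simp
      qed
      ultimately show "e \<in> ?E'" using d by simp
    qed
  qed
  finally show ?thesis
    using uv(1) fE by (simp add: contract_edge_def)
qed

section \<open>Gaps in a set of reals that is finite below a bound\<close>

text \<open>For the contradiction arguments below: a density \<open>x\<close> outside the list
  \<open>T\<close> lies in an open interval that contains no value of \<open>T\<close>.\<close>

lemma gap_around:
  fixes x t c :: real
  assumes "finite (T \<inter> {..c})" "x < c" "x \<notin> T" "t \<in> T" "t < x"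
  shows "\<exists>a b. t \<le> a \<and> a < x \<and> x < b \<and> b \<le> c \<and> (\<forall>y\<in>T. y \<le> a \<or> b \<le> y)"
proof -
  \<comment> \<open>The endpoints are the nearest values of \<open>T\<close> on either side of
    \<open>x\<close>. Inserting \<open>c\<close> gives a right endpoint even if \<open>T\<close> has
    no value between \<open>x\<close> and \<open>c\<close>; the left one exists because of
    \<open>t\<close>.\<close>
  let ?A = "T \<inter> {..<x}" and ?B = "insert c (T \<inter> {x<..c})"
  have fin: "finite ?A" "finite ?B"
    using assms(1,2) by (auto intro: finite_subset[of _ "T \<inter> {..c}"])
  have ne: "?A \<noteq> {}" using assms(4,5) by auto
  have A: "t \<le> Max ?A" "Max ?A < x"
    using fin ne assms(4,5) by auto
  have B: "x < Min ?B" "Min ?B \<le> c"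
    using fin(2) assms(2) by (auto simp: Min_gr_iff)
  have "y \<le> Max ?A \<or> Min ?B \<le> y" if y: "y \<in> T" for y
  proof -
    have "y \<noteq> x" using y assms(3) by blast
    then consider "y \<in> ?A" | "y \<in> ?B" | "c < y"
      using y by (cases "y < x"; cases "c < y") auto
    then show ?thesis
    proof cases
      case 1
      then show ?thesis using Max_ge[OF fin(1)] by blast
    next
      case 2
      then show ?thesis using Min_le[OF fin(2)] by blast
    next
      case 3
      then show ?thesis using B(2) by linarith
    qed
  qed
  then show ?thesis using A B by blast
qed

section \<open>Limiting densities below 3/2\<close>

lemma limiting_density_below_one:
  assumes mc: "minor_closed \<F>" and d: "limiting_density \<F> = ereal x" and "x < 1"
  shows "\<exists>i::nat. x = real i / (real i + 1)"
proof (rule ccontr)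
  assume none: "\<nexists>i::nat. x = real i / (real i + 1)"
  define T where "T = range (\<lambda>i::nat. real i / (real i + 1))"
  have "x \<notin> T" using none by (auto simp: T_def)
  have "0 \<in> T" unfolding T_def by (rule image_eqI[of _ _ 0]) auto
  moreover have "0 \<le> x" using limiting_density_nonneg[of \<F>] d by simp
  ultimately have "0 < x" using \<open>x \<notin> T\<close> by (cases "x = 0") auto
  \<comment> \<open>The values \<open>i / (i + 1)\<close> accumulate at \<open>1\<close> only, so
    any \<open>c\<close> strictly between \<open>x\<close> and \<open>1\<close> has finitely many of
    them below it.\<close>
  define c where "c = (x + 1) / 2"
  have c: "x < c" "c < 1" using \<open>x < 1\<close> by (auto simp: c_def)
  have "T \<inter> {..c} \<subseteq> (\<lambda>i::nat. real i / (real i + 1)) ` {..nat \<lfloor>c / (1 - c)\<rfloor>}"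
  proof
    fix y assume "y \<in> T \<inter> {..c}"
    then obtain i :: nat where i: "y = real i / (real i + 1)" "real i / (real i + 1) \<le> c"
      by (auto simp: T_def)
    then have "real i \<le> c / (1 - c)" using c(2) by (simp add: field_simps)
    then have "i \<le> nat \<lfloor>c / (1 - c)\<rfloor>" by linarith
    then show "y \<in> (\<lambda>i::nat. real i / (real i + 1)) ` {..nat \<lfloor>c / (1 - c)\<rfloor>}"
      using i(1) by blast
  qed
  then have "finite (T \<inter> {..c})" by (rule finite_subset) simp
  then obtain a b where ab: "0 \<le> a" "a < x" "x < b" "b \<le> c" and gap: "\<And>y. y \<in> T \<Longrightarrow> y \<le> a \<or> b \<le> y"
    using gap_around[OF _ c(1) \<open>x \<notin> T\<close> \<open>0 \<in> T\<close> \<open>0 < x\<close>] by blast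
  have "limiting_density \<F> < ereal b" using d ab by simp
  then obtain K where K: "\<And>V E W. (V, E) \<in> \<F> \<Longrightarrow> W \<subseteq> V \<Longrightarrow>
      b * real (card W) \<le> real (card (edges_in E W)) \<Longrightarrow> card W \<le> K"
    by (rule dense_sets_bounded[OF mc]) blast
  have bound: "real (card E) \<le> a * real (card V) + 2 ^ K" if G: "(V, E) \<in> \<F>" for V E
  proof (rule edge_bound_of_split[OF _ ab(1)])
    show s: "simple_graph (V, E)" by (rule minor_closed_simple[OF mc G])
    show "card W \<le> K" if "W \<subseteq> V" "b * real (card W) \<le> real (card (edges_in E W))" for W
      using K[OF G] that .
    fix W assume W: "W \<subseteq> V" "W \<noteq> {}" "separated E W"
    obtain S where S: "S \<subseteq> W" "S \<noteq> {}" "separated E S" "card S \<le> card (edges_in E S) + 1"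
      using tree_piece[OF s W] by blast
    have "finite S" using s S(1) W(1) by (auto simp: simple_graph_def intro: finite_subset)
    then have pos: "0 < card S" using S(2) by (simp add: card_gt_0_iff)
    have "real (card (edges_in E S)) \<le> a * real (card S)
        \<or> b * real (card S) \<le> real (card (edges_in E S))"
    \<comment> \<open>A piece with at least as many edges as vertices has density at least
      \<open>1\<close>, hence above \<open>b\<close>. Otherwise it has exactly
      \<open>|S| - 1\<close> edges, so its density is a value of \<open>T\<close> and the gap
      decides.\<close>
    proof (cases "card S \<le> card (edges_in E S)")
      case True
      have "b * real (card S) \<le> 1 * real (card S)"
        using ab(4) c(2) by (intro mult_right_mono) auto
      then show ?thesis using True by simp
    next
      case False
      then have eq: "real (card S) = real (card (edges_in E S)) + 1" using S(4) by simp
      have "real (card (edges_in E S)) / real (card S) \<in> T"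
        unfolding T_def eq by blast
      from gap[OF this] show ?thesis using pos by (simp add: field_simps)
    qed
    then show "\<exists>S\<subseteq>W. S \<noteq> {} \<and> separated E S \<and>
        (real (card (edges_in E S)) \<le> a * real (card S)
         \<or> b * real (card S) \<le> real (card (edges_in E S)))"
      using S by blast
  qed
  have "limiting_density \<F> \<le> ereal a"
  proof (rule limiting_density_le[OF mc ab(1), of "2 ^ K"])
    fix G assume "G \<in> \<F>"
    then show "real (card (snd G)) \<le> a * real (card (fst G)) + 2 ^ K"
      using bound[of "fst G" "snd G"] by simp
  qed simp
  then show False using d ab(2) by simp
qed

section \<open>Densities from 1 to 3/2\<close>

text \<open>The arithmetic conditions on the order and the number of edges of a set from
  \<open>triangle_piece\<close> that contains a triangle and has density below \<open>3/2\<close>.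
  They leave one \<open>e\<close> for each even \<open>v\<close> and two for each odd
  \<open>v\<close>.\<close>

definition triangle_densities :: "real set" where
  "triangle_densities = {real e / real v | e v :: nat. 3 \<le> v \<and> 3 * v \<le> 2 * e + 3 \<and> 2 * e < 3 * v}"

lemma finite_triangle_densities_below:
  assumes "c < 3/2"
  shows "finite (triangle_densities \<inter> {..c})"
proof -
  \<comment> \<open>Combining \<open>e \<le> c v\<close> with \<open>3 v \<le> 2 e + 3\<close>
    yields \<open>v (3 - 2 c) \<le> 3\<close>, which bounds \<open>v\<close>; then
    \<open>2 e < 3 v\<close> bounds \<open>e\<close>.\<close>
  define N where "N = nat \<lceil>3 / (3 - 2 * c)\<rceil>"
  have "triangle_densities \<inter> {..c} \<subseteq> (\<lambda>(e, v). real e / real v) ` ({..2 * N} \<times> {..N})"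
  proof
    fix y assume y: "y \<in> triangle_densities \<inter> {..c}"
    then obtain e v :: nat where ev: "y = real e / real v" "3 \<le> v" "3 * v \<le> 2 * e + 3" "2 * e < 3 * v"
      by (auto simp: triangle_densities_def)
    have "real e \<le> c * real v" using y ev(1,2) by (simp add: field_simps)
    moreover have "3 * real v \<le> 2 * real e + 3" using ev(3) by linarith
    ultimately have "real v * (3 - 2 * c) \<le> 3" by (simp add: algebra_simps)
    then have "real v \<le> 3 / (3 - 2 * c)" using assms by (simp add: pos_le_divide_eq)
    then have "v \<le> N" unfolding N_def by linarith
    moreover have "e \<le> 2 * N" using ev(4) \<open>v \<le> N\<close> by linarith
    ultimately show "y \<in> (\<lambda>(e, v). real e / real v) ` ({..2 * N} \<times> {..N})"
      using ev(1) by force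
  qed
  then show ?thesis by (rule finite_subset) auto
qed

text \<open>The constraints force \<open>e = 3 k - 1\<close> for \<open>v = 2 k\<close>, and
  \<open>e = 3 k\<close> or \<open>e = 3 k + 1\<close> for \<open>v = 2 k + 1\<close>. Up to the
  shift \<open>i = k - 1\<close> in the first and third case these are the three sequences.\<close>

lemma triangle_densities_subset:
  "triangle_densities \<subseteq> {3 * real i / (2 * real i + 1) | i :: nat. i \<ge> 1}
    \<union> {(3 * real i + 2) / (2 * real i + 2) | i :: nat. i \<ge> 1}
    \<union> {(3 * real i + 4) / (2 * real i + 3) | i :: nat. i \<ge> 1}"
    (is "_ \<subseteq> ?A \<union> ?B \<union> ?C")
proof
  fix y assume "y \<in> triangle_densities"
  then obtain e v :: nat where ev: "y = real e / real v" "3 \<le> v" "3 * v \<le> 2 * e + 3" "2 * e < 3 * v"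
    by (auto simp: triangle_densities_def)
  show "y \<in> ?A \<union> ?B \<union> ?C"
  proof (cases "even v")
    case True
    then obtain k where "v = 2 * k" by blast
    define i where "i = k - 1"
    have i: "v = 2 * i + 2" "e = 3 * i + 2" "1 \<le> i"
      using ev \<open>v = 2 * k\<close> by (auto simp: i_def)
    then have "y = (3 * real i + 2) / (2 * real i + 2)" using ev(1) by (simp add: add.commute)
    then show ?thesis using i(3) by blast
  next
    case False
    then obtain k where k: "v = 2 * k + 1" using oddE by blast
    then have "e = 3 * k \<or> e = 3 * k + 1" "1 \<le> k" using ev by auto
    then consider "e = 3 * k" | "e = 3 * k + 1" "2 \<le> k" | "e = 4" "v = 3"
      using k by (cases "k = 1") auto
    then show ?thesis
    proof cases
      case 1
      then have "y = 3 * real k / (2 * real k + 1)" using ev(1) k by simp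
      then show ?thesis using \<open>1 \<le> k\<close> by blast
    next
      case 2
      define i where "i = k - 1"
      have "real e = 3 * real i + 4" "real v = 2 * real i + 3" "1 \<le> i"
        using 2 k by (auto simp: i_def)
      then have "y = (3 * real i + 4) / (2 * real i + 3)" using ev(1) by simp
      then show ?thesis using \<open>1 \<le> i\<close> by blast
    next
      case 3
      \<comment> \<open>No simple graph has four edges on three vertices, but the quotient occurs for \<open>i = 4\<close>.\<close>
      then have "y = 3 * real 4 / (2 * real 4 + 1)" using ev(1) by simp
      then have "\<exists>i\<ge>1. y = 3 * real i / (2 * real i + 1)" by (intro exI[of _ 4]) simp
      then show ?thesis by blast
    qed
  qed
qed

text \<open>If \<open>x\<close> lay in a gap from \<open>a\<close> to \<open>b\<close>, induction on
  the order would bound the edges by \<open>a\<close> times the order plus a constant: isolated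
  vertices are deleted, edges in no triangle are contracted, and what remains is split into triangle
  pieces.\<close>

lemma limiting_density_between_one_and_three_halves:
  assumes mc: "minor_closed \<F>" and d: "limiting_density \<F> = ereal x" and x: "1 \<le> x" "x < 3/2"
  shows "x \<in> triangle_densities"
proof (rule ccontr)
  assume "x \<notin> triangle_densities"
  \<comment> \<open>The value of a single triangle. It makes the left endpoint \<open>a\<close> of
    the gap at least \<open>1\<close>, which the contraction step requires.\<close>
  have "1 \<in> triangle_densities"
    unfolding triangle_densities_def by (auto intro!: exI[of _ 3])
  then have "1 < x" using x \<open>x \<notin> triangle_densities\<close> by (cases "x = 1") auto
  define c where "c = (x + 3/2) / 2"
  have c: "x < c" "c < 3/2" using x by (auto simp: c_def)
  obtain a b where ab: "1 \<le> a" "a < x" "x < b" "b \<le> c"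
    and gap: "\<And>y. y \<in> triangle_densities \<Longrightarrow> y \<le> a \<or> b \<le> y"
    using gap_around[OF finite_triangle_densities_below[OF c(2)] c(1) \<open>x \<notin> _\<close> \<open>1 \<in> _\<close> \<open>1 < x\<close>]
    by blast
  have "limiting_density \<F> < ereal b" using d ab by simp
  then obtain K where K: "\<And>V E W. (V, E) \<in> \<F> \<Longrightarrow> W \<subseteq> V \<Longrightarrow>
      b * real (card W) \<le> real (card (edges_in E W)) \<Longrightarrow> card W \<le> K"
    by (rule dense_sets_bounded[OF mc]) blast
  have bound: "real (card E) \<le> a * real (card V) + 2 ^ K" if "(V, E) \<in> \<F>" for V E
    using that
  proof (induction "card V" arbitrary: V E rule: less_induct)
    case less
    have s: "simple_graph (V, E)" by (rule minor_closed_simple[OF mc less.prems])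
    have fin: "finite V" "finite E"
      using s simple_graph_finite_edges[OF s] by (auto simp: simple_graph_def)
    show ?case
    \<comment> \<open>Without isolated vertices every piece contains an edge, and later a triangle,
      so that it has at least three vertices.\<close>
    proof (cases "\<exists>z\<in>V. \<forall>e\<in>E. z \<notin> e")
      case True
      then obtain z where z: "z \<in> V" "\<And>e. e \<in> E \<Longrightarrow> z \<notin> e" by blast
      have "(V - {z}, E) \<in> \<F>"
        using s z by (intro minor_closed_subgraph[OF mc less.prems]) (auto simp: simple_graph_def)
      moreover have "card (V - {z}) < card V" using z(1) fin(1) by (rule card_Diff1_less[rotated])
      ultimately have "real (card E) \<le> a * real (card (V - {z})) + 2 ^ K"
        using less.hyps by blast
      moreover have "a * real (card (V - {z})) \<le> a * real (card V)"
        using ab(1) fin(1) by (intro mult_left_mono) (auto intro: card_mono)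
      ultimately show ?thesis by linarith
    next
      case no_isolated: False
      show ?thesis
      proof (cases "\<forall>u v. {u, v} \<in> E \<longrightarrow> (\<exists>w. {u, w} \<in> E \<and> {v, w} \<in> E)")
        case False
        then obtain u v where uv: "{u, v} \<in> E" "\<nexists>w. {u, w} \<in> E \<and> {v, w} \<in> E" by blast
        have "u \<noteq> v" "v \<in> V" using s uv(1) by (auto simp: simple_graph_def)
        let ?G = "contract_edge u v (V, E)"
        have "?G \<in> \<F>"
          using uv(1) \<open>u \<noteq> v\<close> by (intro minor_closed_step[OF mc less.prems] contraction) auto
        moreover have fG: "fst ?G = V - {v}" by (simp add: contract_edge_def)
        ultimately have "(V - {v}, snd ?G) \<in> \<F>" by (metis prod.collapse)
        moreover have lt: "card (V - {v}) < card V"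
          using \<open>v \<in> V\<close> fin(1) by (rule card_Diff1_less[rotated])
        ultimately have "real (card (snd ?G)) \<le> a * real (card (V - {v})) + 2 ^ K"
          using less.hyps by blast
        \<comment> \<open>The contraction loses one vertex and at most one edge; the loss is
          absorbed because \<open>a \<ge> 1\<close>.\<close>
        moreover have "real (card E) \<le> real (card (snd ?G)) + 1"
          using card_contract_edge_ge[OF s uv(1) \<open>u \<noteq> v\<close> uv(2)] by linarith
        moreover have "real (card (V - {v})) = real (card V) - 1"
          using \<open>v \<in> V\<close> fin(1) lt by simp
        ultimately show ?thesis using ab(1) by (simp add: algebra_simps)
      next
        case tri: True
        show ?thesis
        proof (rule edge_bound_of_split[OF s])
          show "0 \<le> a" using ab(1) by simp
          show "card W \<le> K" if "W \<subseteq> V" "b * real (card W) \<le> real (card (edges_in E W))" for W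
            using K[OF less.prems] that .
          fix W assume W: "W \<subseteq> V" "W \<noteq> {}" "separated E W"
          obtain S where S: "S \<subseteq> W" "S \<noteq> {}" "separated E S" "3 * card S \<le> 2 * card (edges_in E S) + 3"
            using triangle_piece[OF s W] tri by blast
          have "finite S" using fin(1) S(1) W(1) by (auto intro: finite_subset)
          obtain p where "p \<in> S" using S(2) by blast
          then obtain e where e: "e \<in> E" "p \<in> e" using no_isolated S(1) W(1) by blast
          obtain q where q: "{p, q} \<in> E"
            using edge_obtain[OF s e(1)] e by (metis insertE insert_commute singletonD)
          obtain r where r: "{p, r} \<in> E" "{q, r} \<in> E" using tri q by blast
          have "q \<in> S" "r \<in> S"
            using separated_edge[OF S(3)] q r(1) \<open>p \<in> S\<close> by auto
          moreover have "p \<noteq> q" "p \<noteq> r" "q \<noteq> r" using s q r by (auto simp: simple_graph_def)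
          ultimately have "card {p, q, r} = 3" "{p, q, r} \<subseteq> S" using \<open>p \<in> S\<close> by auto
          then have "3 \<le> card S" using card_mono[OF \<open>finite S\<close>] by metis
          have "real (card (edges_in E S)) \<le> a * real (card S)
              \<or> b * real (card S) \<le> real (card (edges_in E S))"
          \<comment> \<open>Below \<open>3/2\<close> the density of the piece is a listed value and
            hence avoids the gap. From \<open>3/2\<close> on it exceeds \<open>b\<close>.\<close>
          proof (cases "2 * card (edges_in E S) < 3 * card S")
            case True
            then have "real (card (edges_in E S)) / real (card S) \<in> triangle_densities"
              unfolding triangle_densities_def using S(4) \<open>3 \<le> card S\<close> by blast
            moreover have "0 < real (card S)" using \<open>3 \<le> card S\<close> by linarith
            ultimately show ?thesis
              using gap by (metis pos_divide_le_eq pos_le_divide_eq)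
          next
            case False
            then have "3 * real (card S) \<le> 2 * real (card (edges_in E S))" by linarith
            moreover have "b * real (card S) \<le> 3/2 * real (card S)"
              using ab(4) c(2) by (intro mult_right_mono) auto
            ultimately show ?thesis by linarith
          qed
          then show "\<exists>S\<subseteq>W. S \<noteq> {} \<and> separated E S \<and>
              (real (card (edges_in E S)) \<le> a * real (card S)
               \<or> b * real (card S) \<le> real (card (edges_in E S)))"
            using S by blast
        qed
      qed
    qed
  qed
  have "limiting_density \<F> \<le> ereal a"
  proof (rule limiting_density_le[OF mc, of _ "2 ^ K"])
    fix G assume "G \<in> \<F>"
    then show "real (card (snd G)) \<le> a * real (card (fst G)) + 2 ^ K"
      using bound[of "fst G" "snd G"] by simp
  qed (use ab(1) in auto)
  then show False using d ab(2) by simp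
qed

section \<open>Edgeless and sparse graphs\<close>

lemma simple_contract_edge:
  assumes s: "simple_graph (V, E)" and uv: "{u, v} \<in> E" "u \<noteq> v"
  shows "simple_graph (contract_edge u v (V, E))"
proof -
  let ?\<phi> = "\<lambda>x. if x = v then u else x"
  have V: "finite V" "u \<in> V" "\<And>d. d \<in> E \<Longrightarrow> d \<subseteq> V" using s uv by (auto simp: simple_graph_def)
  have "?\<phi> ` d \<subseteq> V - {v}" if "d \<in> E" for d
    using V(2) V(3)[OF that] uv(2) by auto
  then show ?thesis
    using V(1) by (auto simp: simple_graph_def contract_edge_def)
qed

text \<open>Every edge at \<open>v\<close> acquires the end \<open>u\<close>, so an edge that misses
  the merged vertex is an unchanged old edge.\<close>

lemma contract_edge_avoids:
  assumes "e \<in> snd (contract_edge u v (V, E))" "u \<notin> e"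
  shows "e \<in> E" "v \<notin> e"
proof -
  let ?\<phi> = "\<lambda>x. if x = v then u else x"
  obtain d where d: "d \<in> E" "e = ?\<phi> ` d"
    using assms(1) by (auto simp: contract_edge_def)
  have "v \<notin> d" using assms(2) d(2) by auto
  then have "?\<phi> ` d = id ` d" by (intro image_cong) auto
  then show "e \<in> E" "v \<notin> e" using d \<open>v \<notin> d\<close> by auto
qed

text \<open>A criterion for concrete families: both kinds of deletion are instances of passing to a
  subgraph.\<close>

lemma minor_closed_by_subgraphs:
  assumes simple: "\<And>G. G \<in> \<F> \<Longrightarrow> simple_graph G"
    and sub: "\<And>V E V' E'. (V, E) \<in> \<F> \<Longrightarrow> V' \<subseteq> V \<Longrightarrow> E' \<subseteq> E \<Longrightarrow> \<forall>e\<in>E'. e \<subseteq> V' \<Longrightarrow> (V', E') \<in> \<F>"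
    and contr: "\<And>V E u v. (V, E) \<in> \<F> \<Longrightarrow> {u, v} \<in> E \<Longrightarrow> u \<noteq> v \<Longrightarrow> contract_edge u v (V, E) \<in> \<F>"
    and iso: "\<And>V E f. (V, E) \<in> \<F> \<Longrightarrow> inj_on f V \<Longrightarrow> (f ` V, (\<lambda>e. f ` e) ` E) \<in> \<F>"
  shows "minor_closed \<F>"
proof (rule minor_closedI)
  fix G H assume G: "G \<in> \<F>" and "minor_step G H"
  obtain V E where [simp]: "G = (V, E)" by (cases G)
  have e: "\<forall>e\<in>E. e \<subseteq> V" using simple[OF G] by (auto simp: simple_graph_def)
  from \<open>minor_step G H\<close> show "H \<in> \<F>"
  proof cases
    case (contraction u v)
    then show ?thesis using contr[of V E] G by simp
  next
    case (edge_deletion e)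
    then show ?thesis using sub[of V E V "E - {e}"] G e by auto
  next
    case (vertex_deletion v)
    then show ?thesis using sub[of V E "V - {v}" "{e \<in> E. v \<notin> e}"] G e by auto
  qed
next
  fix G H :: "nat graph" assume G: "G \<in> \<F>" and "graph_iso G H"
  then obtain f where "bij_betw f (fst G) (fst H)" "snd H = (\<lambda>e. f ` e) ` snd G"
    by (auto simp: graph_iso_def)
  then have "inj_on f (fst G)" "H = (f ` fst G, (\<lambda>e. f ` e) ` snd G)"
    by (auto simp: bij_betw_def prod_eq_iff)
  then show "H \<in> \<F>" using iso[of "fst G" "snd G" f] G by simp
qed (use simple in blast)

lemma simple_subgraph:
  "simple_graph (V, E) \<Longrightarrow> V' \<subseteq> V \<Longrightarrow> E' \<subseteq> E \<Longrightarrow> \<forall>e\<in>E'. e \<subseteq> V' \<Longrightarrow> simple_graph (V', E')"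
  by (auto simp: simple_graph_def intro: finite_subset)

lemma simple_image:
  assumes "simple_graph (V, E)" "inj_on f V"
  shows "simple_graph (f ` V, (\<lambda>e. f ` e) ` E)"
proof -
  have "card (f ` e) = 2" if "e \<in> E" for e
    using assms that card_image[OF inj_on_subset[OF assms(2), of e]] by (auto simp: simple_graph_def)
  then show ?thesis using assms(1) by (auto simp: simple_graph_def)
qed

lemma inj_on_image_edges:
  assumes "simple_graph (V, E)" "inj_on f V"
  shows "inj_on (\<lambda>e. f ` e) E"
proof (rule inj_on_subset)
  show "inj_on (\<lambda>e. f ` e) (Pow V)" by (rule inj_on_image_Pow[OF assms(2)])
  show "E \<subseteq> Pow V" using assms(1) by (auto simp: simple_graph_def)
qed

lemma edges_in_image:
  assumes "simple_graph (V, E)" "inj_on f V" "S \<subseteq> V"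
  shows "edges_in ((\<lambda>e. f ` e) ` E) (f ` S) = (\<lambda>e. f ` e) ` edges_in E S"
proof -
  have "f ` e \<subseteq> f ` S \<longleftrightarrow> e \<subseteq> S" if "e \<in> E" for e
    using assms that by (intro inj_on_image_subset_iff[of f V]) (auto simp: simple_graph_def)
  then show ?thesis unfolding edges_in_def by blast
qed

section \<open>Base families for the apex construction\<close>

definition edgeless_graphs :: "nat graph set" where
  "edgeless_graphs = {G. finite (fst G) \<and> snd G = {}}"

lemma minor_closed_edgeless: "minor_closed edgeless_graphs"
  by (rule minor_closed_by_subgraphs)
    (auto simp: edgeless_graphs_def simple_graph_def intro: finite_subset)

text \<open>Asking this of every vertex subset prevents isolated vertices from compensating a dense
  part. For \<open>s = 0\<close> the edges form a matching; for \<open>s \<le> 2\<close> the graphs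
  are forests, since a cycle of length \<open>k\<close> would need \<open>k \<le> s\<close>.\<close>

definition sparse_graphs :: "nat \<Rightarrow> nat graph set" where
  "sparse_graphs s =
     {G. simple_graph G \<and> (\<forall>S\<subseteq>fst G. 2 * card (edges_in (snd G) S) \<le> card S + s)}"

lemma sparse_graphs_bound:
  "(V, E) \<in> sparse_graphs s \<Longrightarrow> S \<subseteq> V \<Longrightarrow> 2 * card (edges_in E S) \<le> card S + s"
  by (simp add: sparse_graphs_def)

text \<open>For contractions, compare a set \<open>S\<close> containing \<open>u\<close> with
  \<open>S\<close> plus \<open>v\<close> in the old graph: the latter has one more vertex but also
  the additional edge \<open>uv\<close>, so the inequality even improves. Sets without
  \<open>u\<close> gain no edges.\<close>

lemma minor_closed_sparse: "minor_closed (sparse_graphs s)"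
proof (rule minor_closed_by_subgraphs)
  fix V E V' E'
  assume G: "(V, E) \<in> sparse_graphs s" and sub: "V' \<subseteq> V" "E' \<subseteq> E" "\<forall>e\<in>E'. e \<subseteq> V'"
  have simple: "simple_graph (V, E)" using G by (simp add: sparse_graphs_def)
  have "2 * card (edges_in E' S) \<le> card S + s" if "S \<subseteq> V'" for S
  proof -
    have "card (edges_in E' S) \<le> card (edges_in E S)"
      using simple_graph_finite_edges[OF simple] sub(2)
      by (intro card_mono) (auto simp: edges_in_def)
    moreover have "2 * card (edges_in E S) \<le> card S + s"
      using G that sub(1) by (auto simp: sparse_graphs_def)
    ultimately show ?thesis by linarith
  qed
  then show "(V', E') \<in> sparse_graphs s"
    using simple_subgraph[OF simple sub] by (simp add: sparse_graphs_def)
next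
  fix V E u v
  assume G: "(V, E) \<in> sparse_graphs s" and uv: "{u, v} \<in> E" "u \<noteq> v"
  let ?\<phi> = "\<lambda>x. if x = v then u else x"
  let ?E' = "snd (contract_edge u v (V, E))"
  have simple: "simple_graph (V, E)" using G by (simp add: sparse_graphs_def)
  have fin: "finite V" "finite E" and "v \<in> V"
    using simple simple_graph_finite_edges[OF simple] uv by (auto simp: simple_graph_def)
  have "2 * card (edges_in ?E' S) \<le> card S + s" if S: "S \<subseteq> V - {v}" for S
  proof (cases "u \<in> S")
    case False
    have "edges_in ?E' S \<subseteq> edges_in E S"
      using contract_edge_avoids(1)[of _ u v V E] False by (auto simp: edges_in_def)
    then have "card (edges_in ?E' S) \<le> card (edges_in E S)"
      using fin by (intro card_mono) auto
    moreover have "2 * card (edges_in E S) \<le> card S + s" using S by (intro sparse_graphs_bound[OF G]) auto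
    ultimately show ?thesis by linarith
  next
    case True
    have "edges_in ?E' S \<subseteq> (\<lambda>d. ?\<phi> ` d) ` (edges_in E (insert v S) - {{u, v}})"
    proof
      fix e assume "e \<in> edges_in ?E' S"
      then obtain d where d: "d \<in> E" "e = ?\<phi> ` d" "card e = 2" "e \<subseteq> S"
        by (auto simp: edges_in_def contract_edge_def)
      have "d \<subseteq> insert v S" using d(2,4) by (auto split: if_splits)
      moreover have "d \<noteq> {u, v}"
      proof
        assume "d = {u, v}"
        then have "e = {u}" using d(2) by auto
        then show False using d(3) by simp
      qed
      ultimately show "e \<in> (\<lambda>d. ?\<phi> ` d) ` (edges_in E (insert v S) - {{u, v}})"
        using d(1,2) by (intro image_eqI[of _ _ d]) (auto simp: edges_in_def)
    qed
    then have "card (edges_in ?E' S) \<le> card (edges_in E (insert v S) - {{u, v}})"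
      using fin(2) by (intro surj_card_le) auto
    moreover have "{u, v} \<in> edges_in E (insert v S)" using uv True by (auto simp: edges_in_def)
    then have "card (edges_in E (insert v S) - {{u, v}}) + 1 = card (edges_in E (insert v S))"
      using fin(2) by (metis Suc_eq_plus1 card_Suc_Diff1 finite_edges_in)
    moreover have "2 * card (edges_in E (insert v S)) \<le> card (insert v S) + s"
      using S \<open>v \<in> V\<close> by (intro sparse_graphs_bound[OF G]) auto
    moreover have "finite S" using S fin(1) by (auto intro: finite_subset)
    then have "card (insert v S) \<le> card S + 1" by (simp add: card_insert_if)
    ultimately show ?thesis by linarith
  qed
  moreover have "fst (contract_edge u v (V, E)) = V - {v}" by (simp add: contract_edge_def)
  ultimately show "contract_edge u v (V, E) \<in> sparse_graphs s"
    using simple_contract_edge[OF simple uv] by (simp add: sparse_graphs_def)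
next
  fix V E and f :: "nat \<Rightarrow> nat"
  assume G: "(V, E) \<in> sparse_graphs s" and f: "inj_on f V"
  have simple: "simple_graph (V, E)" using G by (simp add: sparse_graphs_def)
  have "2 * card (edges_in ((\<lambda>e. f ` e) ` E) S) \<le> card S + s" if "S \<subseteq> f ` V" for S
  proof -
    obtain R where R: "R \<subseteq> V" "S = f ` R" using \<open>S \<subseteq> f ` V\<close> by (auto simp: subset_image_iff)
    have "card (edges_in ((\<lambda>e. f ` e) ` E) S) \<le> card (edges_in E R)"
      unfolding R(2) edges_in_image[OF simple f R(1)]
      using simple_graph_finite_edges[OF simple] by (intro card_image_le) auto
    moreover have "card S = card R" unfolding R(2) by (intro card_image inj_on_subset[OF f R(1)])
    moreover have "2 * card (edges_in E R) \<le> card R + s" using G R(1) by (auto simp: sparse_graphs_def)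
    ultimately show ?thesis by linarith
  qed
  then show "(f ` V, (\<lambda>e. f ` e) ` E) \<in> sparse_graphs s"
    using simple_image[OF simple f] by (simp add: sparse_graphs_def)
qed (simp add: sparse_graphs_def)

text \<open>A set through the new vertex gains one vertex and at most one edge, which raises
  \<open>2 e(S) - |S|\<close> by at most one.\<close>

lemma sparse_add_pendant:
  assumes G: "(V, E) \<in> sparse_graphs s" and "x \<notin> V" "y \<in> V"
  shows "(insert x V, insert {x, y} E) \<in> sparse_graphs (Suc s)"
    "card (insert x V) = card V + 1" "card (insert {x, y} E) = card E + 1"
proof -
  have simple: "simple_graph (V, E)" using G by (simp add: sparse_graphs_def)
  have fin: "finite V" "finite E"
    using simple simple_graph_finite_edges[OF simple] by (auto simp: simple_graph_def)
  have EV: "e \<subseteq> V" if "e \<in> E" for e using simple that by (auto simp: simple_graph_def)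
  show "card (insert x V) = card V + 1" using fin(1) \<open>x \<notin> V\<close> by simp
  have "{x, y} \<notin> E" using EV \<open>x \<notin> V\<close> by blast
  then show "card (insert {x, y} E) = card E + 1" using fin(2) by simp
  have "2 * card (edges_in (insert {x, y} E) S) \<le> card S + Suc s" if S: "S \<subseteq> insert x V" for S
  proof (cases "x \<in> S")
    case True
    have "card (edges_in (insert {x, y} E) S) \<le> card (insert {x, y} (edges_in E (S - {x})))"
      using fin(2) EV \<open>x \<notin> V\<close> by (intro card_mono) (auto simp: edges_in_def)
    also have "\<dots> \<le> card (edges_in E (S - {x})) + 1"
      using fin(2) by (simp add: card_insert_if)
    finally have "card (edges_in (insert {x, y} E) S) \<le> card (edges_in E (S - {x})) + 1" .
    moreover have "2 * card (edges_in E (S - {x})) \<le> card (S - {x}) + s"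
      using S by (intro sparse_graphs_bound[OF G]) auto
    moreover have "card S = card (S - {x}) + 1"
      using True S fin(1) by (metis Suc_eq_plus1 card_Suc_Diff1 finite_insert finite_subset)
    ultimately show ?thesis by linarith
  next
    case False
    then have "edges_in (insert {x, y} E) S = edges_in E S" by (auto simp: edges_in_def)
    moreover have "2 * card (edges_in E S) \<le> card S + s"
      using S False by (intro sparse_graphs_bound[OF G]) auto
    ultimately show ?thesis by simp
  qed
  moreover have "simple_graph (insert x V, insert {x, y} E)"
    using simple \<open>x \<notin> V\<close> \<open>y \<in> V\<close> by (auto simp: simple_graph_def card_2_iff doubleton_eq_iff)
  ultimately show "(insert x V, insert {x, y} E) \<in> sparse_graphs (Suc s)"
    by (simp add: sparse_graphs_def)
qed

text \<open>Two new vertices pay exactly for one new edge, so \<open>s\<close> does not change. A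
  set with at most one of them gains no edge.\<close>

lemma sparse_add_disjoint_edge:
  assumes G: "(V, E) \<in> sparse_graphs s" and "x \<notin> V" "y \<notin> V" "x \<noteq> y"
  shows "(insert x (insert y V), insert {x, y} E) \<in> sparse_graphs s"
    "card (insert x (insert y V)) = card V + 2" "card (insert {x, y} E) = card E + 1"
proof -
  have simple: "simple_graph (V, E)" using G by (simp add: sparse_graphs_def)
  have fin: "finite V" "finite E"
    using simple simple_graph_finite_edges[OF simple] by (auto simp: simple_graph_def)
  have EV: "e \<subseteq> V" if "e \<in> E" for e using simple that by (auto simp: simple_graph_def)
  show "card (insert x (insert y V)) = card V + 2" using fin(1) assms by simp
  have "{x, y} \<notin> E" using EV \<open>x \<notin> V\<close> by blast
  then show "card (insert {x, y} E) = card E + 1" using fin(2) by simp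
  have "2 * card (edges_in (insert {x, y} E) S) \<le> card S + s" if S: "S \<subseteq> insert x (insert y V)" for S
  proof (cases "{x, y} \<subseteq> S")
    case True
    have fS: "finite S" using S fin(1) by (auto intro: finite_subset)
    have "card (edges_in (insert {x, y} E) S) \<le> card (insert {x, y} (edges_in E (S - {x, y})))"
      using fin(2) EV assms by (intro card_mono) (auto simp: edges_in_def)
    also have "\<dots> \<le> card (edges_in E (S - {x, y})) + 1"
      using fin(2) by (simp add: card_insert_if)
    finally have "card (edges_in (insert {x, y} E) S) \<le> card (edges_in E (S - {x, y})) + 1" .
    moreover have "2 * card (edges_in E (S - {x, y})) \<le> card (S - {x, y}) + s"
      using S by (intro sparse_graphs_bound[OF G]) auto
    moreover have "card S = card (S - {x, y}) + 2"
      using card_Diff_subset[OF _ True] card_mono[OF fS True] \<open>x \<noteq> y\<close> by simp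
    ultimately show ?thesis by linarith
  next
    case False
    have fS: "finite S" using S fin(1) by (auto intro: finite_subset)
    have "edges_in (insert {x, y} E) S = edges_in E (S \<inter> V)"
      using False EV by (auto simp: edges_in_def)
    moreover have "2 * card (edges_in E (S \<inter> V)) \<le> card (S \<inter> V) + s"
      using G by (auto simp: sparse_graphs_def)
    moreover have "card (S \<inter> V) \<le> card S" using fS by (intro card_mono) auto
    ultimately show ?thesis by simp
  qed
  moreover have "simple_graph (insert x (insert y V), insert {x, y} E)"
    using simple \<open>x \<noteq> y\<close> by (auto simp: simple_graph_def)
  ultimately show "(insert x (insert y V), insert {x, y} E) \<in> sparse_graphs s"
    by (simp add: sparse_graphs_def)
qed

text \<open>The graph is a matching of \<open>i\<close> edges to which \<open>s\<close> pendant
  edges are added one by one; \<open>1 \<le> i\<close> provides a vertex to attach them to.\<close>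

lemma sparse_graph_exists:
  assumes "1 \<le> i"
  shows "\<exists>(V, E)\<in>sparse_graphs s. card V = 2 * i + s \<and> card E = i + s"
proof (induction s)
  case 0
  show ?case
  proof (induction i)
    case 0
    have "({}, {}) \<in> sparse_graphs 0" by (auto simp: sparse_graphs_def simple_graph_def edges_in_def)
    then show ?case by (intro bexI[of _ "({}, {})"]) auto
  next
    case (Suc i)
    then obtain V E where G: "(V, E) \<in> sparse_graphs 0" "card V = 2 * i" "card E = i" by auto
    have "finite V" using G(1) by (auto simp: sparse_graphs_def simple_graph_def)
    then obtain x y where xy: "x \<notin> V" "y \<notin> V" "x \<noteq> y"
      by (metis finite_insert ex_new_if_finite infinite_UNIV_nat insertCI)
    show ?case
      using sparse_add_disjoint_edge[OF G(1) xy] G(2,3)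
      by (intro bexI[of _ "(insert x (insert y V), insert {x, y} E)"]) auto
  qed
next
  case (Suc s)
  then obtain V E where G: "(V, E) \<in> sparse_graphs s" "card V = 2 * i + s" "card E = i + s" by auto
  have "finite V" using G(1) by (auto simp: sparse_graphs_def simple_graph_def)
  then obtain x where x: "x \<notin> V" by (metis ex_new_if_finite infinite_UNIV_nat)
  obtain y where y: "y \<in> V" using G(2) assms by fastforce
  show ?case
    using sparse_add_pendant[OF G(1) x y] G(2,3)
    by (intro bexI[of _ "(insert x V, insert {x, y} E)"]) auto
qed

section \<open>Adding an apex to every part\<close>

text \<open>
  The fibres of \<open>c\<close> are unions of components, and \<open>U\<close> contains at most one vertex of each fibre.
  Labels instead of components make the family visibly closed under minors.
\<close>

definition apex_structure ::
    "nat graph set \<Rightarrow> nat \<Rightarrow> nat set \<Rightarrow> nat set set \<Rightarrow> (nat \<Rightarrow> nat) \<Rightarrow> nat set \<Rightarrow> bool" where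
  "apex_structure M N V E c U \<longleftrightarrow> U \<subseteq> V \<and> inj_on c U \<and> (\<forall>e\<in>E. \<exists>k. e \<subseteq> c -` {k}) \<and>
     (\<forall>k. card (V \<inter> c -` {k}) \<le> N \<and> (V \<inter> c -` {k} - U, edges_in E (c -` {k} - U)) \<in> M)"

definition apex_family :: "nat graph set \<Rightarrow> nat \<Rightarrow> nat graph set" where
  "apex_family M N = {(V, E). simple_graph (V, E) \<and> (\<exists>c U. apex_structure M N V E c U)}"

lemma apex_familyI: "simple_graph (V, E) \<Longrightarrow> apex_structure M N V E c U \<Longrightarrow> (V, E) \<in> apex_family M N"
  by (auto simp: apex_family_def)

lemma apex_familyE:
  assumes "(V, E) \<in> apex_family M N"
  obtains c U where "simple_graph (V, E)" "apex_structure M N V E c U"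
  using assms by (auto simp: apex_family_def)

section \<open>Closure of the apex construction under minors and disjoint unions\<close>

lemma apex_structure_subgraph:
  assumes M: "minor_closed M" and simple: "simple_graph (V, E)" and A: "apex_structure M N V E c U"
    and sub: "V' \<subseteq> V" "E' \<subseteq> E" "\<forall>e\<in>E'. e \<subseteq> V'"
  shows "apex_structure M N V' E' c (U \<inter> V')"
  unfolding apex_structure_def
proof (intro conjI ballI allI)
  show "inj_on c (U \<inter> V')" using A by (auto simp: apex_structure_def intro: inj_on_subset)
  show "\<exists>k. e \<subseteq> c -` {k}" if "e \<in> E'" for e
    using A that sub(2) by (auto simp: apex_structure_def)
  fix k
  have "finite V" using simple by (simp add: simple_graph_def)
  then have "card (V' \<inter> c -` {k}) \<le> card (V \<inter> c -` {k})" using sub(1) by (intro card_mono) auto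
  also have "\<dots> \<le> N" using A by (simp add: apex_structure_def)
  finally show "card (V' \<inter> c -` {k}) \<le> N" .
  have inM: "(V \<inter> c -` {k} - U, edges_in E (c -` {k} - U)) \<in> M"
    using A by (simp add: apex_structure_def)
  \<comment> \<open>Edges of \<open>E'\<close> lie inside \<open>V'\<close>, so avoiding the
    remaining apices is the same as avoiding all of \<open>U\<close>.\<close>
  have "e \<subseteq> c -` {k} - U" if "e \<in> E'" "e \<subseteq> c -` {k} - U \<inter> V'" for e
    using that sub(3) by blast
  then have E': "edges_in E' (c -` {k} - U \<inter> V') \<subseteq> edges_in E (c -` {k} - U)"
    using sub(2) by (auto simp: edges_in_def)
  have "V' \<inter> c -` {k} - (U \<inter> V') \<subseteq> V \<inter> c -` {k} - U" using sub(1) by blast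
  then show "(V' \<inter> c -` {k} - (U \<inter> V'), edges_in E' (c -` {k} - (U \<inter> V'))) \<in> M"
    by (rule minor_closed_subgraph[OF M inM _ E']) (use sub(3) in \<open>auto simp: edges_in_def\<close>)
qed auto

text \<open>Contracting an edge at an apex deletes a vertex from the rest of its fibre.\<close>

lemma apex_structure_contract:
  assumes M: "minor_closed M" and simple: "simple_graph (V, E)" and A: "apex_structure M N V E c U"
    and uv: "{u, v} \<in> E" "u \<noteq> v"
  shows "\<exists>U'. apex_structure M N (V - {v}) (snd (contract_edge u v (V, E))) c U'"
proof -
  let ?\<phi> = "\<lambda>x. if x = v then u else x"
  let ?E' = "snd (contract_edge u v (V, E))"
  have V: "finite V" "u \<in> V" "v \<in> V" using simple uv by (auto simp: simple_graph_def)
  have U: "U \<subseteq> V" "inj_on c U" and mono: "\<And>e. e \<in> E \<Longrightarrow> \<exists>k. e \<subseteq> c -` {k}"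
    and cardN: "\<And>k. card (V \<inter> c -` {k}) \<le> N"
    and inM: "\<And>k. (V \<inter> c -` {k} - U, edges_in E (c -` {k} - U)) \<in> M"
    using A by (auto simp: apex_structure_def)
  \<comment> \<open>Edges stay within a fibre, so the old labels remain valid after the two ends are
    merged.\<close>
  have cuv: "c u = c v" using mono[OF uv(1)] by auto
  have c_\<phi>: "c (?\<phi> x) = c x" for x using cuv by simp
  have mono': "\<exists>k. e \<subseteq> c -` {k}" if "e \<in> ?E'" for e
  proof -
    obtain d where d: "d \<in> E" "e = ?\<phi> ` d" using \<open>e \<in> ?E'\<close> by (auto simp: contract_edge_def)
    then obtain k where "d \<subseteq> c -` {k}" using mono by blast
    have "c y = k" if y: "y \<in> e" for y
    proof -
      obtain x where "x \<in> d" "y = ?\<phi> x" using y d(2) by blast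
      then show ?thesis using c_\<phi>[of x] \<open>d \<subseteq> c -` {k}\<close> by auto
    qed
    then show ?thesis by (intro exI[of _ k]) auto
  qed
  have E'V: "e \<subseteq> V - {v}" if "e \<in> ?E'" for e
    using simple_contract_edge[OF simple uv] that by (auto simp: simple_graph_def contract_edge_def)
  have cardN': "card ((V - {v}) \<inter> c -` {k}) \<le> N" for k
  proof -
    have "card ((V - {v}) \<inter> c -` {k}) \<le> card (V \<inter> c -` {k})" using V(1) by (intro card_mono) auto
    then show ?thesis using cardN[of k] by linarith
  qed
  show ?thesis
  proof (cases "u \<in> U \<or> v \<in> U")
    case True
    \<comment> \<open>The merged vertex, named \<open>u\<close>, becomes the apex of its fibre,
      whichever end was the apex before. Injectivity survives because \<open>u\<close> and
      \<open>v\<close> have the same label.\<close>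
    define U' where "U' = insert u (U - {v})"
    have "inj_on c U'"
    proof (rule inj_onI)
      fix x y assume xy: "x \<in> U'" "y \<in> U'" "c x = c y"
      show "x = y"
      proof (cases "u \<in> U")
        case True
        then have "x \<in> U" "y \<in> U" using xy by (auto simp: U'_def)
        then show ?thesis using U(2) xy(3) by (auto dest: inj_onD)
      next
        case False
        then have "v \<in> U" using \<open>u \<in> U \<or> v \<in> U\<close> by simp
        have "z = u" if "z \<in> U'" "c z = c u" for z
          using inj_onD[OF U(2), of z v] \<open>v \<in> U\<close> cuv that by (auto simp: U'_def)
        moreover have "x = y" if "x \<noteq> u" "y \<noteq> u"
          using inj_onD[OF U(2) xy(3)] xy that by (auto simp: U'_def)
        ultimately show ?thesis using xy by metis
      qed
    qed
    moreover have "((V - {v}) \<inter> c -` {k} - U', edges_in ?E' (c -` {k} - U')) \<in> M" for k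
    proof (rule minor_closed_subgraph[OF M inM[of k]])
      show "edges_in ?E' (c -` {k} - U') \<subseteq> edges_in E (c -` {k} - U)"
      proof
        fix e assume "e \<in> edges_in ?E' (c -` {k} - U')"
        then have e: "e \<in> ?E'" "e \<subseteq> c -` {k}" "e \<inter> U' = {}" by (auto simp: edges_in_def)
        then have "u \<notin> e" by (auto simp: U'_def)
        then have "e \<in> E" "v \<notin> e" using contract_edge_avoids[OF e(1)] by auto
        then show "e \<in> edges_in E (c -` {k} - U)" using e by (auto simp: edges_in_def U'_def)
      qed
      show "(V - {v}) \<inter> c -` {k} - U' \<subseteq> V \<inter> c -` {k} - U" by (auto simp: U'_def)
      show "e \<subseteq> (V - {v}) \<inter> c -` {k} - U'" if "e \<in> edges_in ?E' (c -` {k} - U')" for e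
        using that E'V[of e] by (auto simp: edges_in_def)
    qed
    moreover have "U' \<subseteq> V - {v}" using U(1) V(2) uv(2) by (auto simp: U'_def)
    ultimately have "apex_structure M N (V - {v}) ?E' c U'"
      using mono' cardN' by (simp add: apex_structure_def)
    then show ?thesis ..
  next
    case False
    have "((V - {v}) \<inter> c -` {k} - U, edges_in ?E' (c -` {k} - U)) \<in> M" for k
    \<comment> \<open>Neither end is an apex. In the fibre of \<open>u\<close> the contraction takes
      place within the member of \<open>M\<close>; the other fibres keep their edges.\<close>
    proof (cases "k = c u")
      case True
      let ?S = "c -` {k} - U"
      have uvS: "u \<in> ?S" "v \<in> ?S" using True False cuv by auto
      have "{u, v} \<in> edges_in E ?S" using uv(1) uvS by (simp add: edges_in_def)
      then have "contract_edge u v (V \<inter> c -` {k} - U, edges_in E ?S) \<in> M"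
        using uv(2) by (intro minor_closed_step[OF M inM[of k]] contraction) auto
      moreover have "fst (contract_edge u v (V \<inter> c -` {k} - U, edges_in E ?S)) = (V - {v}) \<inter> c -` {k} - U"
        by (auto simp: contract_edge_def)
      ultimately have "((V - {v}) \<inter> c -` {k} - U, snd (contract_edge u v (V \<inter> c -` {k} - U, edges_in E ?S))) \<in> M"
        by (metis prod.collapse)
      then show ?thesis
      proof (rule minor_closed_subgraph[OF M])
        show "edges_in ?E' ?S \<subseteq> snd (contract_edge u v (V \<inter> c -` {k} - U, edges_in E ?S))"
        proof
          fix e assume "e \<in> edges_in ?E' ?S"
          then obtain d where d: "d \<in> E" "e = ?\<phi> ` d" "card e = 2" "e \<subseteq> ?S"
            by (auto simp: edges_in_def contract_edge_def)
          have "x \<in> ?S" if "x \<in> d" for x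
          proof (cases "x = v")
            case True
            then show ?thesis using uvS by simp
          next
            case False
            then have "x \<in> e" using d(2) that by force
            then show ?thesis using d(4) by blast
          qed
          then have "d \<in> edges_in E ?S" using d(1) by (auto simp: edges_in_def)
          then show "e \<in> snd (contract_edge u v (V \<inter> c -` {k} - U, edges_in E ?S))"
            using d(2,3) by (simp add: contract_edge_def)
        qed
        show "e \<subseteq> (V - {v}) \<inter> c -` {k} - U" if "e \<in> edges_in ?E' ?S" for e
          using that E'V[of e] by (auto simp: edges_in_def)
      qed simp
    next
      case False
      show ?thesis
      proof (rule minor_closed_subgraph[OF M inM[of k]])
        show "edges_in ?E' (c -` {k} - U) \<subseteq> edges_in E (c -` {k} - U)"
        proof
          fix e assume "e \<in> edges_in ?E' (c -` {k} - U)"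
          then have e: "e \<in> ?E'" "e \<subseteq> c -` {k} - U" by (auto simp: edges_in_def)
          then have "u \<notin> e" using False by auto
          then show "e \<in> edges_in E (c -` {k} - U)"
            using e contract_edge_avoids(1)[OF e(1)] by (simp add: edges_in_def)
        qed
        show "e \<subseteq> (V - {v}) \<inter> c -` {k} - U" if "e \<in> edges_in ?E' (c -` {k} - U)" for e
          using that E'V[of e] by (auto simp: edges_in_def)
      qed auto
    qed
    moreover have "U \<subseteq> V - {v}" using U(1) False by auto
    ultimately have "apex_structure M N (V - {v}) ?E' c U"
      using mono' cardN' U(2) by (simp add: apex_structure_def)
    then show ?thesis ..
  qed
qed

text \<open>The labels are pulled back along the inverse of \<open>f\<close> on \<open>V\<close>;
  each fibre is then the image of an old fibre and stays in \<open>M\<close> by isomorphism.\<close>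

lemma apex_structure_image:
  assumes M: "minor_closed M" and simple: "simple_graph (V, E)" and A: "apex_structure M N V E c U"
    and f: "inj_on f V"
  shows "apex_structure M N (f ` V) ((\<lambda>e. f ` e) ` E) (c \<circ> inv_into V f) (f ` U)"
proof -
  let ?c = "c \<circ> inv_into V f"
  have U: "U \<subseteq> V" "inj_on c U" and mono: "\<And>e. e \<in> E \<Longrightarrow> \<exists>k. e \<subseteq> c -` {k}"
    and cardN: "\<And>k. card (V \<inter> c -` {k}) \<le> N"
    and inM: "\<And>k. (V \<inter> c -` {k} - U, edges_in E (c -` {k} - U)) \<in> M"
    using A by (auto simp: apex_structure_def)
  have EV: "e \<subseteq> V" if "e \<in> E" for e using simple that by (auto simp: simple_graph_def)
  have c[simp]: "?c (f x) = c x" if "x \<in> V" for x using that f by simp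
  have fib: "f ` V \<inter> ?c -` {k} = f ` (V \<inter> c -` {k})" for k
  proof (intro equalityI subsetI)
    fix y assume "y \<in> f ` V \<inter> ?c -` {k}"
    then obtain x where "x \<in> V" "y = f x" "?c (f x) = k" by auto
    then show "y \<in> f ` (V \<inter> c -` {k})" using c by auto
  qed (use c in auto)
  show ?thesis
    unfolding apex_structure_def
  proof (intro conjI ballI allI)
    show "f ` U \<subseteq> f ` V" using U(1) by blast
    show "inj_on ?c (f ` U)"
    proof (rule inj_onI)
      fix x y assume "x \<in> f ` U" "y \<in> f ` U" "?c x = ?c y"
      then obtain x' y' where "x' \<in> U" "y' \<in> U" "x = f x'" "y = f y'" by blast
      moreover have "c x' = c y'" using calculation U(1) \<open>?c x = ?c y\<close> c by (metis subsetD)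
      ultimately show "x = y" using inj_onD[OF U(2)] by metis
    qed
    show "\<exists>k. e \<subseteq> ?c -` {k}" if e: "e \<in> (\<lambda>e. f ` e) ` E" for e
    proof -
      obtain d where d: "d \<in> E" "e = f ` d" using e by blast
      obtain k where k: "d \<subseteq> c -` {k}" using mono[OF d(1)] by blast
      have "?c y = k" if y: "y \<in> e" for y
      proof -
        obtain x where "x \<in> d" "y = f x" using y d(2) by blast
        then show ?thesis using c[of x] k EV[OF d(1)] by auto
      qed
      then show ?thesis by (intro exI[of _ k]) auto
    qed
    fix k
    show "card (f ` V \<inter> ?c -` {k}) \<le> N"
      unfolding fib using card_image[OF inj_on_subset[OF f, of "V \<inter> c -` {k}"]] cardN[of k] by simp
    let ?S = "V \<inter> c -` {k} - U"
    have V': "f ` V \<inter> ?c -` {k} - f ` U = f ` ?S"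
      unfolding fib using U(1) by (intro inj_on_image_set_diff[OF f, symmetric]) auto
    have "edges_in ((\<lambda>e. f ` e) ` E) (?c -` {k} - f ` U) = edges_in ((\<lambda>e. f ` e) ` E) (f ` ?S)"
      unfolding V'[symmetric] using EV by (auto simp: edges_in_def)
    also have "\<dots> = (\<lambda>e. f ` e) ` edges_in E ?S" by (rule edges_in_image[OF simple f]) auto
    also have "edges_in E ?S = edges_in E (c -` {k} - U)" using EV by (auto simp: edges_in_def)
    finally have E': "edges_in ((\<lambda>e. f ` e) ` E) (?c -` {k} - f ` U) =
      (\<lambda>e. f ` e) ` edges_in E (c -` {k} - U)" .
    have "bij_betw f ?S (f ` ?S)" by (intro inj_on_imp_bij_betw inj_on_subset[OF f]) auto
    then have "graph_iso (?S, edges_in E (c -` {k} - U))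
        (f ` ?S, (\<lambda>e. f ` e) ` edges_in E (c -` {k} - U))"
      by (auto simp: graph_iso_def)
    then show "(f ` V \<inter> ?c -` {k} - f ` U, edges_in ((\<lambda>e. f ` e) ` E) (?c -` {k} - f ` U)) \<in> M"
      unfolding V' E' using minor_closed_iso[OF M inM[of k]] by blast
  qed
qed

lemma minor_closed_apex:
  assumes M: "minor_closed M"
  shows "minor_closed (apex_family M N)"
proof (rule minor_closed_by_subgraphs)
  fix G assume "G \<in> apex_family M N"
  then show "simple_graph G" by (auto simp: apex_family_def)
next
  fix V E V' E'
  assume G: "(V, E) \<in> apex_family M N" and sub: "V' \<subseteq> V" "E' \<subseteq> E" "\<forall>e\<in>E'. e \<subseteq> V'"
  obtain c U where "simple_graph (V, E)" "apex_structure M N V E c U" by (rule apex_familyE[OF G])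
  then show "(V', E') \<in> apex_family M N"
    using sub by (intro apex_familyI[OF simple_subgraph apex_structure_subgraph[OF M]])
next
  fix V E u v
  assume G: "(V, E) \<in> apex_family M N" and uv: "{u, v} \<in> E" "u \<noteq> v"
  obtain c U where G: "simple_graph (V, E)" "apex_structure M N V E c U" by (rule apex_familyE[OF G])
  have "contract_edge u v (V, E) = (V - {v}, snd (contract_edge u v (V, E)))"
    by (simp add: contract_edge_def)
  then show "contract_edge u v (V, E) \<in> apex_family M N"
    using simple_contract_edge[OF G(1) uv] apex_structure_contract[OF M G uv] apex_familyI by metis
next
  fix V E and f :: "nat \<Rightarrow> nat"
  assume G: "(V, E) \<in> apex_family M N" and f: "inj_on f V"
  obtain c U where G: "simple_graph (V, E)" "apex_structure M N V E c U" by (rule apex_familyE[OF G])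
  show "(f ` V, (\<lambda>e. f ` e) ` E) \<in> apex_family M N"
    by (rule apex_familyI[OF simple_image[OF G(1) f] apex_structure_image[OF M G f]])
qed

lemma apex_family_disjoint_union:
  assumes G1: "(V1, E1) \<in> apex_family M N" and G2: "(V2, E2) \<in> apex_family M N" and disj: "V1 \<inter> V2 = {}"
  shows "(V1 \<union> V2, E1 \<union> E2) \<in> apex_family M N"
proof -
  obtain c1 U1 where s1: "simple_graph (V1, E1)" and A1: "apex_structure M N V1 E1 c1 U1"
    by (rule apex_familyE[OF G1])
  obtain c2 U2 where s2: "simple_graph (V2, E2)" and A2: "apex_structure M N V2 E2 c2 U2"
    by (rule apex_familyE[OF G2])
  \<comment> \<open>Even labels on \<open>V1\<close> and odd labels on \<open>V2\<close> keep the
    fibres of the two graphs apart, so each new fibre is a fibre of one of them.\<close>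
  define c where "c x = (if x \<in> V1 then 2 * c1 x else 2 * c2 x + 1)" for x
  have EV: "\<And>e. e \<in> E1 \<Longrightarrow> e \<subseteq> V1 \<and> e \<noteq> {}" "\<And>e. e \<in> E2 \<Longrightarrow> e \<subseteq> V2 \<and> e \<noteq> {}"
    using s1 s2 by (auto simp: simple_graph_def)
  have U: "U1 \<subseteq> V1" "U2 \<subseteq> V2" using A1 A2 by (auto simp: apex_structure_def)
  have c1: "c x = 2 * c1 x" if "x \<in> V1" for x using that by (simp add: c_def)
  have c2: "c x = 2 * c2 x + 1" if "x \<in> V2" for x using that disj by (auto simp: c_def)
  have "apex_structure M N (V1 \<union> V2) (E1 \<union> E2) c (U1 \<union> U2)"
    unfolding apex_structure_def
  proof (intro conjI ballI allI)
    show "U1 \<union> U2 \<subseteq> V1 \<union> V2" using U by blast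
    show "inj_on c (U1 \<union> U2)"
    proof (rule inj_onI)
      fix x y assume xy: "x \<in> U1 \<union> U2" "y \<in> U1 \<union> U2" "c x = c y"
      have par: "even (c z) \<longleftrightarrow> z \<in> U1" if "z \<in> U1 \<union> U2" for z
        using that c1[of z] c2[of z] U disj by auto
      show "x = y"
      proof (cases "x \<in> U1")
        case True
        then have "y \<in> U1" using par[OF xy(1)] par[OF xy(2)] xy(3) by simp
        then have "x \<in> V1" "y \<in> V1" using True U(1) by auto
        then have "c1 x = c1 y" using xy(3) c1[of x] c1[of y] by simp
        then show ?thesis using True \<open>y \<in> U1\<close> A1 by (auto simp: apex_structure_def dest: inj_onD)
      next
        case False
        then have "x \<in> U2" "y \<in> U2" using par[OF xy(1)] par[OF xy(2)] xy by auto
        then have "x \<in> V2" "y \<in> V2" using U(2) by auto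
        then have "c2 x = c2 y" using xy(3) c2[of x] c2[of y] by simp
        then show ?thesis using \<open>x \<in> U2\<close> \<open>y \<in> U2\<close> A2 by (auto simp: apex_structure_def dest: inj_onD)
      qed
    qed
    show "\<exists>k. e \<subseteq> c -` {k}" if "e \<in> E1 \<union> E2" for e
      using that
    proof
      assume e: "e \<in> E1"
      then obtain k where "e \<subseteq> c1 -` {k}" using A1 by (auto simp: apex_structure_def)
      then have "c x = 2 * k" if "x \<in> e" for x
        using that c1[of x] EV(1)[OF e] by auto
      then show ?thesis by (intro exI[of _ "2 * k"]) auto
    next
      assume e: "e \<in> E2"
      then obtain k where "e \<subseteq> c2 -` {k}" using A2 by (auto simp: apex_structure_def)
      then have "c x = 2 * k + 1" if "x \<in> e" for x
        using that c2[of x] EV(2)[OF e] by auto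
      then show ?thesis by (intro exI[of _ "2 * k + 1"]) auto
    qed
    fix k
    have "(\<exists>j. (V1 \<union> V2) \<inter> c -` {k} = V1 \<inter> c1 -` {j} \<and>
          (V1 \<union> V2) \<inter> c -` {k} - (U1 \<union> U2) = V1 \<inter> c1 -` {j} - U1 \<and>
          edges_in (E1 \<union> E2) (c -` {k} - (U1 \<union> U2)) = edges_in E1 (c1 -` {j} - U1)) \<or>
        (\<exists>j. (V1 \<union> V2) \<inter> c -` {k} = V2 \<inter> c2 -` {j} \<and>
          (V1 \<union> V2) \<inter> c -` {k} - (U1 \<union> U2) = V2 \<inter> c2 -` {j} - U2 \<and>
          edges_in (E1 \<union> E2) (c -` {k} - (U1 \<union> U2)) = edges_in E2 (c2 -` {j} - U2))"
    proof (cases "even k")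
      case True
      then obtain j where k: "k = 2 * j" by blast
      have x1: "c x = k \<longleftrightarrow> c1 x = j" if "x \<in> V1" for x using c1[OF that] k by simp
      have x2: "c x \<noteq> k" if "x \<in> V2" for x using c2[OF that] k by presburger
      have V: "(V1 \<union> V2) \<inter> c -` {k} = V1 \<inter> c1 -` {j}" using x1 x2 by auto
      moreover have "V1 \<inter> c1 -` {j} - (U1 \<union> U2) = V1 \<inter> c1 -` {j} - U1" using U disj by auto
      moreover have "edges_in (E1 \<union> E2) (c -` {k} - (U1 \<union> U2)) = edges_in E1 (c1 -` {j} - U1)"
      proof (intro equalityI subsetI)
        fix e assume "e \<in> edges_in (E1 \<union> E2) (c -` {k} - (U1 \<union> U2))"
        then have e: "e \<in> E1 \<or> e \<in> E2" "e \<subseteq> c -` {k} - (U1 \<union> U2)" by (auto simp: edges_in_def)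
        have "e \<in> E1" using e EV(2)[of e] x2 by auto
        then show "e \<in> edges_in E1 (c1 -` {j} - U1)" using e EV(1)[of e] x1 by (auto simp: edges_in_def)
      next
        fix e assume "e \<in> edges_in E1 (c1 -` {j} - U1)"
        then have e: "e \<in> E1" "e \<subseteq> c1 -` {j} - U1" by (auto simp: edges_in_def)
        have "x \<in> c -` {k} - (U1 \<union> U2)" if "x \<in> e" for x
          using subsetD[OF e(2) that] subsetD[OF conjunct1[OF EV(1)[OF e(1)]] that] x1[of x] U disj
          by auto
        then show "e \<in> edges_in (E1 \<union> E2) (c -` {k} - (U1 \<union> U2))"
          using e(1) by (auto simp: edges_in_def)
      qed
      ultimately show ?thesis by (intro disjI1 exI[of _ j]) simp
    next
      case False
      then obtain j where k: "k = 2 * j + 1" using oddE by blast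
      have x2: "c x = k \<longleftrightarrow> c2 x = j" if "x \<in> V2" for x using c2[OF that] k by simp
      have x1: "c x \<noteq> k" if "x \<in> V1" for x using c1[OF that] k by presburger
      have V: "(V1 \<union> V2) \<inter> c -` {k} = V2 \<inter> c2 -` {j}" using x1 x2 by auto
      moreover have "V2 \<inter> c2 -` {j} - (U1 \<union> U2) = V2 \<inter> c2 -` {j} - U2" using U disj by auto
      moreover have "edges_in (E1 \<union> E2) (c -` {k} - (U1 \<union> U2)) = edges_in E2 (c2 -` {j} - U2)"
      proof (intro equalityI subsetI)
        fix e assume "e \<in> edges_in (E1 \<union> E2) (c -` {k} - (U1 \<union> U2))"
        then have e: "e \<in> E1 \<or> e \<in> E2" "e \<subseteq> c -` {k} - (U1 \<union> U2)" by (auto simp: edges_in_def)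
        have "e \<in> E2" using e EV(1)[of e] x1 by auto
        then show "e \<in> edges_in E2 (c2 -` {j} - U2)" using e EV(2)[of e] x2 by (auto simp: edges_in_def)
      next
        fix e assume "e \<in> edges_in E2 (c2 -` {j} - U2)"
        then have e: "e \<in> E2" "e \<subseteq> c2 -` {j} - U2" by (auto simp: edges_in_def)
        have "x \<in> c -` {k} - (U1 \<union> U2)" if "x \<in> e" for x
          using subsetD[OF e(2) that] subsetD[OF conjunct1[OF EV(2)[OF e(1)]] that] x2[of x] U disj
          by auto
        then show "e \<in> edges_in (E1 \<union> E2) (c -` {k} - (U1 \<union> U2))"
          using e(1) by (auto simp: edges_in_def)
      qed
      ultimately show ?thesis by (intro disjI2 exI[of _ j]) simp
    qed
    then have "card ((V1 \<union> V2) \<inter> c -` {k}) \<le> N \<and>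
        ((V1 \<union> V2) \<inter> c -` {k} - (U1 \<union> U2), edges_in (E1 \<union> E2) (c -` {k} - (U1 \<union> U2))) \<in> M"
      using A1 A2 unfolding apex_structure_def by (elim disjE exE conjE) simp_all
    then show "card ((V1 \<union> V2) \<inter> c -` {k}) \<le> N"
      "((V1 \<union> V2) \<inter> c -` {k} - (U1 \<union> U2), edges_in (E1 \<union> E2) (c -` {k} - (U1 \<union> U2))) \<in> M"
      by auto
  qed
  moreover have "simple_graph (V1 \<union> V2, E1 \<union> E2)" using s1 s2 by (auto simp: simple_graph_def)
  ultimately show ?thesis by (rule apex_familyI[rotated])
qed

section \<open>Extremal families\<close>

text \<open>Joining a new apex to all vertices of a member of \<open>M\<close> gives the densest
  kind of fibre. One label suffices for all vertices.\<close>

lemma apex_family_cone: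
  assumes M: "minor_closed M" and G: "(V, E) \<in> M" and "card V < N" and "h \<notin> V"
  shows "(insert h V, E \<union> (\<lambda>x. {h, x}) ` V) \<in> apex_family M N"
    "card (insert h V) = card V + 1" "card (E \<union> (\<lambda>x. {h, x}) ` V) = card E + card V"
proof -
  have simple: "simple_graph (V, E)" by (rule minor_closed_simple[OF M G])
  have fin: "finite V" "finite E"
    using simple simple_graph_finite_edges[OF simple] by (auto simp: simple_graph_def)
  have EV: "e \<subseteq> V" if "e \<in> E" for e using simple that by (auto simp: simple_graph_def)
  show card_V: "card (insert h V) = card V + 1" using fin(1) \<open>h \<notin> V\<close> by simp
  have "inj_on (\<lambda>x. {h, x}) V" by (auto simp: inj_on_def doubleton_eq_iff)
  moreover have "E \<inter> (\<lambda>x. {h, x}) ` V = {}" using EV \<open>h \<notin> V\<close> by blast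
  ultimately show "card (E \<union> (\<lambda>x. {h, x}) ` V) = card E + card V"
    using fin by (simp add: card_Un_disjoint card_image)
  let ?E = "E \<union> (\<lambda>x. {h, x}) ` V"
  have "simple_graph (insert h V, ?E)"
    using simple \<open>h \<notin> V\<close> by (auto simp: simple_graph_def card_2_iff doubleton_eq_iff)
  moreover have "apex_structure M N (insert h V) ?E (\<lambda>_. 0) {h}"
    unfolding apex_structure_def
  proof (intro conjI ballI allI)
    fix k :: nat
    show "card (insert h V \<inter> (\<lambda>_. 0) -` {k}) \<le> N"
      using card_V \<open>card V < N\<close> by (cases "k = 0") auto
    show "(insert h V \<inter> (\<lambda>_. 0) -` {k} - {h}, edges_in ?E ((\<lambda>_. 0) -` {k} - {h})) \<in> M"
    proof (cases "k = 0")
      case True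
      have "insert h V \<inter> (\<lambda>_. 0) -` {k} - {h} = V" using True \<open>h \<notin> V\<close> by auto
      moreover have "edges_in ?E ((\<lambda>_. 0) -` {k} - {h}) = E"
        using True EV \<open>h \<notin> V\<close> by (auto simp: edges_in_def)
      ultimately show ?thesis using G by simp
    next
      case False
      have "({}, {}) \<in> M" by (rule minor_closed_subgraph[OF M G]) auto
      moreover have "edges_in ?E {} = {}" using simple by (auto simp: edges_in_def simple_graph_def)
      ultimately show ?thesis using False by simp
    qed
  qed auto
  ultimately show "(insert h V, ?E) \<in> apex_family M N" by (rule apex_familyI)
qed

lemma apex_family_copies:
  assumes M: "minor_closed M" and G: "(V, E) \<in> apex_family M N"
  shows "\<exists>(V', E')\<in>apex_family M N. card V' = m * card V \<and> card E' = m * card E"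
proof (induction m)
  case 0
  have "({}, {}) \<in> apex_family M N"
    by (rule minor_closed_subgraph[OF minor_closed_apex[OF M] G]) auto
  then show ?case by (intro bexI[of _ "({}, {})"]) auto
next
  case (Suc m)
  then obtain V' E' where G': "(V', E') \<in> apex_family M N" "card V' = m * card V" "card E' = m * card E"
    by auto
  have simple: "simple_graph (V, E)" "simple_graph (V', E')"
    using minor_closed_simple[OF minor_closed_apex[OF M]] G G'(1) by auto
  have fin: "finite V" "finite V'" "finite E" "finite E'"
    using simple simple_graph_finite_edges[OF simple(1)] simple_graph_finite_edges[OF simple(2)]
    by (auto simp: simple_graph_def)
  obtain t where t: "\<And>x. x \<in> V' \<Longrightarrow> x < t"
    using fin(2) by (auto simp: finite_nat_set_iff_bounded)
  \<comment> \<open>Shifting past all vertices of \<open>V'\<close> makes the new copy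
    disjoint.\<close>
  define f where "f x = x + t" for x
  have f: "inj_on f V" by (auto simp: f_def inj_on_def)
  let ?V = "f ` V" and ?E = "(\<lambda>e. f ` e) ` E"
  have "bij_betw f V ?V" using f by (rule inj_on_imp_bij_betw)
  then have "graph_iso (V, E) (?V, ?E)" by (auto simp: graph_iso_def)
  then have copy: "(?V, ?E) \<in> apex_family M N"
    by (rule minor_closed_iso[OF minor_closed_apex[OF M] G])
  have disj: "V' \<inter> ?V = {}" using t by (fastforce simp: f_def)
  have "E' \<inter> ?E = {}"
  proof -
    have "e \<subseteq> V' \<and> e \<noteq> {}" if "e \<in> E'" for e using simple(2) that by (auto simp: simple_graph_def)
    moreover have "e \<subseteq> ?V" if "e \<in> ?E" for e using simple(1) that by (auto simp: simple_graph_def)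
    ultimately show ?thesis using disj by blast
  qed
  then have "card (E' \<union> ?E) = Suc m * card E"
    using fin G'(3) card_image[OF inj_on_image_edges[OF simple(1) f]] by (simp add: card_Un_disjoint)
  moreover have "card (V' \<union> ?V) = Suc m * card V"
    using fin G'(2) disj card_image[OF f] by (simp add: card_Un_disjoint)
  ultimately show ?case
    using apex_family_disjoint_union[OF G'(1) copy disj] by (intro bexI[of _ "(V' \<union> ?V, E' \<union> ?E)"]) auto
qed

text \<open>Every edge lies in one fibre, so it suffices to bound each fibre and to sum. The apex of
  a fibre meets at most one edge per remaining vertex; a fibre without apex is itself in
  \<open>M\<close>.\<close>

lemma apex_family_edge_bound:
  assumes M: "minor_closed M" and G: "(V, E) \<in> apex_family M N"
    and apex: "\<And>V E. (V, E) \<in> M \<Longrightarrow> card V < N \<Longrightarrow>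
      real (card E) + real (card V) \<le> d * (real (card V) + 1)"
    and no_apex: "\<And>V E. (V, E) \<in> M \<Longrightarrow> 0 < card V \<Longrightarrow> real (card E) \<le> d * real (card V)"
  shows "real (card E) \<le> d * real (card V)"
proof -
  obtain c U where simple: "simple_graph (V, E)" and A: "apex_structure M N V E c U"
    by (rule apex_familyE[OF G])
  have fin: "finite V" "finite E"
    using simple simple_graph_finite_edges[OF simple] by (auto simp: simple_graph_def)
  have EV: "e \<subseteq> V" "card e = 2" if "e \<in> E" for e using simple that by (auto simp: simple_graph_def)
  have U: "U \<subseteq> V" "inj_on c U" and mono: "\<And>e. e \<in> E \<Longrightarrow> \<exists>k. e \<subseteq> c -` {k}"
    and cardN: "\<And>k. card (V \<inter> c -` {k}) \<le> N"
    and inM: "\<And>k. (V \<inter> c -` {k} - U, edges_in E (c -` {k} - U)) \<in> M"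
    using A by (auto simp: apex_structure_def)
  have fibre: "real (card (edges_in E (c -` {k}))) \<le> d * real (card (V \<inter> c -` {k}))"
    if k: "k \<in> c ` V" for k
  proof (cases "U \<inter> c -` {k} = {}")
    case True
    have "V \<inter> c -` {k} \<noteq> {}" using k by auto
    then have "0 < card (V \<inter> c -` {k})" using fin(1) by (simp add: card_gt_0_iff)
    moreover have "c -` {k} - U = c -` {k}" "V \<inter> c -` {k} - U = V \<inter> c -` {k}" using True by auto
    ultimately show ?thesis using no_apex[OF inM[of k]] by simp
  next
    case False
    then obtain h where h: "h \<in> U" "c h = k" by auto
    \<comment> \<open>Injectivity of the labels on \<open>U\<close> leaves one apex per
      fibre.\<close>
    have only: "x = h" if "x \<in> U" "c x = k" for x using inj_onD[OF U(2)] that h by auto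
    let ?R = "V \<inter> c -` {k} - U" and ?F = "edges_in E (c -` {k} - U)"
    have "h \<in> V" using h(1) U(1) by blast
    have fibre_eq: "V \<inter> c -` {k} = insert h ?R"
    proof (intro equalityI subsetI)
      fix x assume "x \<in> V \<inter> c -` {k}"
      then show "x \<in> insert h ?R" using only[of x] by (cases "x \<in> U") auto
    qed (use h(2) \<open>h \<in> V\<close> in auto)
    have "h \<notin> ?R" "finite ?R" using h fin(1) by auto
    then have "card (insert h ?R) = card ?R + 1" by simp
    then have card_R: "card (V \<inter> c -` {k}) = card ?R + 1" by (simp only: fibre_eq[symmetric])
    have "edges_in E (c -` {k}) \<subseteq> ?F \<union> (\<lambda>x. {h, x}) ` ?R"
    proof
      fix e assume "e \<in> edges_in E (c -` {k})"
      then have e: "e \<in> E" "e \<subseteq> c -` {k}" by (auto simp: edges_in_def)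
      show "e \<in> ?F \<union> (\<lambda>x. {h, x}) ` ?R"
      proof (cases "h \<in> e")
        case True
        obtain x y where xy: "e = {x, y}" "x \<noteq> y" by (rule edge_obtain[OF simple e(1)])
        define z where "z = (if x = h then y else x)"
        have z: "e = {h, z}" "z \<noteq> h" using True xy by (auto simp: z_def)
        have "z \<notin> U" using only[of z] z e(2) by auto
        then have "z \<in> ?R" using z e(2) EV(1)[OF e(1)] by auto
        then show ?thesis using z(1) by blast
      next
        case False
        have "x \<notin> U" if "x \<in> e" for x using only[of x] False that e(2) by auto
        then have "e \<subseteq> c -` {k} - U" using e(2) by blast
        then show ?thesis using e(1) by (simp add: edges_in_def)
      qed
    qed
    then have "card (edges_in E (c -` {k})) \<le> card (?F \<union> (\<lambda>x. {h, x}) ` ?R)"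
      using fin by (intro card_mono) auto
    also have "\<dots> \<le> card ?F + card ((\<lambda>x. {h, x}) ` ?R)" by (rule card_Un_le)
    also have "\<dots> \<le> card ?F + card ?R" using \<open>finite ?R\<close> by (simp add: card_image_le)
    finally have "real (card (edges_in E (c -` {k}))) \<le> real (card ?F) + real (card ?R)" by linarith
    also have "\<dots> \<le> d * (real (card ?R) + 1)"
      using card_R cardN[of k] by (intro apex[OF inM]) simp
    finally show ?thesis using card_R by (simp add: add.commute)
  qed
  have "E \<subseteq> (\<Union>k\<in>c ` V. edges_in E (c -` {k}))"
  proof
    fix e assume e: "e \<in> E"
    obtain k where k: "e \<subseteq> c -` {k}" using mono[OF e] by blast
    obtain x where "x \<in> e" using EV(2)[OF e] by fastforce
    then have "k \<in> c ` V" using k EV(1)[OF e] by auto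
    then show "e \<in> (\<Union>k\<in>c ` V. edges_in E (c -` {k}))" using e k by (auto simp: edges_in_def)
  qed
  then have "card E \<le> card (\<Union>k\<in>c ` V. edges_in E (c -` {k}))"
    using fin by (intro card_mono) auto
  also have "\<dots> \<le> (\<Sum>k\<in>c ` V. card (edges_in E (c -` {k})))"
    using fin(1) by (intro card_UN_le) auto
  finally have "real (card E) \<le> (\<Sum>k\<in>c ` V. real (card (edges_in E (c -` {k}))))"
    by (metis of_nat_le_iff of_nat_sum)
  also have "\<dots> \<le> (\<Sum>k\<in>c ` V. d * real (card (V \<inter> c -` {k})))" by (intro sum_mono fibre)
  also have "\<dots> = d * real (\<Sum>k\<in>c ` V. card (V \<inter> c -` {k}))" by (simp add: sum_distrib_left)
  also have "(\<Sum>k\<in>c ` V. card (V \<inter> c -` {k})) = card (\<Union>k\<in>c ` V. V \<inter> c -` {k})"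
    using fin(1) by (intro card_UN_disjoint[symmetric]) auto
  also have "(\<Union>k\<in>c ` V. V \<inter> c -` {k}) = V" by auto
  finally show ?thesis .
qed

section \<open>Exactly attained densities and their iteration\<close>

text \<open>The bound holds without error term and is attained at every multiple of
  \<open>q\<close>. This exact form can be fed into the apex construction again, with arbitrarily
  large base graphs.\<close>

definition extremal_family :: "nat graph set \<Rightarrow> real \<Rightarrow> nat \<Rightarrow> bool" where
  "extremal_family \<F> d q \<longleftrightarrow> minor_closed \<F> \<and> 0 < q \<and>
     (\<forall>G\<in>\<F>. real (card (snd G)) \<le> d * real (card (fst G))) \<and>
     (\<forall>m. \<exists>G\<in>\<F>. card (fst G) = m * q \<and> real (card (snd G)) = d * real (m * q))"

lemma extremal_family_upper:
  assumes "extremal_family \<F> d q" "(V, E) \<in> \<F>"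
  shows "real (card E) \<le> d * real (card V)"
proof -
  have "\<forall>G\<in>\<F>. real (card (snd G)) \<le> d * real (card (fst G))"
    using assms(1) by (simp add: extremal_family_def)
  from bspec[OF this assms(2)] show ?thesis by simp
qed

lemma extremal_family_obtain:
  assumes "extremal_family \<F> d q"
  obtains V E where "(V, E) \<in> \<F>" "card V = m * q" "real (card E) = d * real (m * q)"
proof -
  obtain G where "G \<in> \<F>" "card (fst G) = m * q" "real (card (snd G)) = d * real (m * q)"
    using assms unfolding extremal_family_def by blast
  then show ?thesis using that[of "fst G" "snd G"] by simp
qed

lemma extremal_family_nonneg:
  assumes "extremal_family \<F> d q"
  shows "0 \<le> d"
proof -
  obtain V E where "(V, E) \<in> \<F>" "card V = 1 * q" "real (card E) = d * real (1 * q)"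
    by (rule extremal_family_obtain[OF assms])
  then have "0 \<le> d * real q" by (metis mult_1 of_nat_0_le_iff)
  then show ?thesis using assms by (simp add: extremal_family_def zero_le_mult_iff)
qed

lemma extremal_family_limiting_density:
  assumes "extremal_family \<F> d q"
  shows "d \<in> limiting_densities"
proof -
  have "limiting_density \<F> = ereal d"
  proof (rule limiting_density_eq)
    show "0 \<le> d" by (rule extremal_family_nonneg[OF assms])
    show "real (card (snd G)) \<le> d * real (card (fst G))" if "G \<in> \<F>" for G
      using assms that unfolding extremal_family_def by blast
    show "\<exists>G\<in>\<F>. card (fst G) = m * q \<and> real (card (snd G)) = d * real (m * q)" for m
      using assms unfolding extremal_family_def by blast
  qed (use assms in \<open>auto simp: extremal_family_def\<close>)
  then show ?thesis using assms by (auto simp: limiting_densities_def extremal_family_def)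
qed

text \<open>Disjoint copies of the cone over \<open>G\<close> attain the value \<open>d\<close> at
  every multiple of \<open>N\<close>; the two inequalities give the upper bound fibre by
  fibre.\<close>

lemma extremal_apex_family:
  assumes M: "minor_closed M" and G: "(V, E) \<in> M" "N = card V + 1"
    and d: "real (card E) + real (card V) = d * real N"
    and apex: "\<And>V E. (V, E) \<in> M \<Longrightarrow> card V < N \<Longrightarrow>
      real (card E) + real (card V) \<le> d * (real (card V) + 1)"
    and no_apex: "\<And>V E. (V, E) \<in> M \<Longrightarrow> 0 < card V \<Longrightarrow> real (card E) \<le> d * real (card V)"
  shows "extremal_family (apex_family M N) d N"
  unfolding extremal_family_def
proof (intro conjI allI)
  show "minor_closed (apex_family M N)" by (rule minor_closed_apex[OF M])
  show "0 < N" using G(2) by simp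
  show "\<forall>G\<in>apex_family M N. real (card (snd G)) \<le> d * real (card (fst G))"
  proof
    fix G assume "G \<in> apex_family M N"
    then show "real (card (snd G)) \<le> d * real (card (fst G))"
      by (intro apex_family_edge_bound[OF M _ apex no_apex]) simp
  qed
  fix m
  have "finite V" using minor_closed_simple[OF M G(1)] by (simp add: simple_graph_def)
  then obtain h where "h \<notin> V" by (metis ex_new_if_finite infinite_UNIV_nat)
  moreover have "card V < N" using G(2) by simp
  ultimately have cone: "(insert h V, E \<union> (\<lambda>x. {h, x}) ` V) \<in> apex_family M N"
    "card (insert h V) = card V + 1" "card (E \<union> (\<lambda>x. {h, x}) ` V) = card E + card V"
    using apex_family_cone[OF M G(1)] by auto
  obtain V' E' where G': "(V', E') \<in> apex_family M N" "card V' = m * (card V + 1)"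
    "card E' = m * (card E + card V)"
    using apex_family_copies[OF M cone(1), of m] cone(2,3) by auto
  have "real (card E') = real m * (real (card E) + real (card V))" using G'(3) by simp
  also have "\<dots> = d * real (m * N)" unfolding d by simp
  finally show "\<exists>G\<in>apex_family M N. card (fst G) = m * N \<and> real (card (snd G)) = d * real (m * N)"
    using G'(1,2) G(2) by (intro bexI[of _ "(V', E')"]) auto
qed

lemma extremal_edgeless: "extremal_family edgeless_graphs 0 1"
  unfolding extremal_family_def
proof (intro conjI allI)
  show "minor_closed edgeless_graphs" by (rule minor_closed_edgeless)
  show "\<exists>G\<in>edgeless_graphs. card (fst G) = m * 1 \<and> real (card (snd G)) = 0 * real (m * 1)" for m
    by (intro bexI[of _ "({..<m}, {})"]) (auto simp: edgeless_graphs_def)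
qed (auto simp: edgeless_graphs_def)

text \<open>With \<open>n = m q\<close>, the cone over an extremal graph on \<open>n\<close>
  vertices has \<open>(d + 1) n\<close> edges on \<open>n + 1\<close> vertices. Smaller cones are no
  denser because \<open>r / (r + 1)\<close> increases with \<open>r\<close>.\<close>

lemma extremal_family_step:
  assumes F: "extremal_family \<F> d q" and m: "d \<le> real (m * q)"
  shows "\<exists>\<G>. extremal_family \<G> ((d + 1) * real (m * q) / real (m * q + 1)) (m * q + 1)"
proof -
  define n where "n = m * q"
  define d' where "d' = (d + 1) * real n / real (n + 1)"
  have mc: "minor_closed \<F>" using F by (simp add: extremal_family_def)
  note upper = extremal_family_upper[OF F]
  obtain V E where G: "(V, E) \<in> \<F>" "card V = n" "real (card E) = d * real n"
    unfolding n_def by (rule extremal_family_obtain[OF F])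
  have "0 \<le> d" by (rule extremal_family_nonneg[OF F])
  have "0 < real (n + 1)" by simp
  \<comment> \<open>The assumption \<open>d \<le> n\<close> amounts to \<open>d \<le> d'\<close>,
    which takes care of fibres without apex.\<close>
  moreover have "d * real (n + 1) \<le> (d + 1) * real n" using m by (simp add: n_def algebra_simps)
  ultimately have "d \<le> d'" unfolding d'_def by (simp only: pos_le_divide_eq)
  have "extremal_family (apex_family \<F> (n + 1)) d' (n + 1)"
  proof (rule extremal_apex_family[OF mc G(1)])
    show "n + 1 = card V + 1" using G(2) by simp
    show "real (card E) + real (card V) = d' * real (n + 1)"
      using G by (simp add: d'_def field_simps)
    show "real (card E) \<le> d' * real (card V)" if "(V, E) \<in> \<F>" for V E
      using upper[OF that] mult_right_mono[OF \<open>d \<le> d'\<close>, of "real (card V)"] by simp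
    fix V E assume G: "(V, E) \<in> \<F>" "card V < n + 1"
    define r where "r = real (card V)"
    have r: "0 \<le> r" "r \<le> real n" using G(2) by (auto simp: r_def)
    have "real (card E) + r \<le> (d + 1) * r" using upper[OF G(1)] by (simp add: r_def algebra_simps)
    also have "\<dots> = (d + 1) * (r / (r + 1)) * (r + 1)" using r by simp
    also have "\<dots> \<le> (d + 1) * (real n / (real n + 1)) * (r + 1)"
      using r \<open>0 \<le> d\<close> by (intro mult_left_mono mult_right_mono) (auto simp: field_simps)
    also have "\<dots> = d' * (r + 1)" by (simp add: d'_def add.commute)
    finally show "real (card E) + real (card V) \<le> d' * (real (card V) + 1)" by (simp add: r_def)
  qed
  then show ?thesis unfolding d'_def n_def by blast
qed

text \<open>The cone over \<open>i\<close> isolated vertices is the star with \<open>i\<close>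
  edges.\<close>

lemma extremal_superparticular: "\<exists>\<F> q. extremal_family \<F> (real i / (real i + 1)) q"
proof -
  obtain \<G> where "extremal_family \<G> ((0 + 1) * real (i * 1) / real (i * 1 + 1)) (i * 1 + 1)"
    using extremal_family_step[OF extremal_edgeless, of i] by auto
  moreover have "(0 + 1) * real (i * 1) / real (i * 1 + 1) = real i / (real i + 1)"
    by (simp add: add.commute)
  ultimately show ?thesis by metis
qed

text \<open>The cone over a sparse graph with \<open>2 i + s\<close> vertices and
  \<open>i + s\<close> edges has \<open>3 i + 2 s\<close> edges. The cases
  \<open>s = 0, 1, 2\<close> give the three sequences between \<open>1\<close> and
  \<open>3/2\<close>.\<close>

lemma extremal_apex_sparse:
  assumes "1 \<le> i" "s \<le> 2"
  shows "\<exists>\<F> q. extremal_family \<F> ((3 * real i + 2 * real s) / (2 * real i + real s + 1)) q"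
proof -
  define N where "N = 2 * i + s + 1"
  define d where "d = (3 * real i + 2 * real s) / (2 * real i + real s + 1)"
  obtain V E where G: "(V, E) \<in> sparse_graphs s" "card V = 2 * i + s" "card E = i + s"
    using sparse_graph_exists[OF assms(1), of s] by blast
  have total: "2 * card E \<le> card V + s" if "(V, E) \<in> sparse_graphs s" for V E
  proof -
    have "edges_in E V = E"
      using that by (auto simp: sparse_graphs_def simple_graph_def edges_in_def)
    then show ?thesis using sparse_graphs_bound[OF that subset_refl] by simp
  qed
  have "1 \<le> d" using assms(1) by (simp add: d_def field_simps)
  have "extremal_family (apex_family (sparse_graphs s) N) d N"
  proof (rule extremal_apex_family[OF minor_closed_sparse G(1)])
    show "N = card V + 1" using G(2) by (simp add: N_def)
    show "real (card E) + real (card V) = d * real N"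
      using G by (simp add: d_def N_def field_simps)
    show "real (card E) \<le> d * real (card V)" if VE: "(V, E) \<in> sparse_graphs s" "0 < card V" for V E
    proof -
      \<comment> \<open>From \<open>2 e \<le> v + 2\<close> and \<open>v \<ge> 1\<close>; for
        \<open>v = 1\<close> integrality is used.\<close>
      have "card E \<le> card V" using total[OF VE(1)] VE(2) assms(2) by linarith
      then have "real (card E) \<le> 1 * real (card V)" by simp
      also have "\<dots> \<le> d * real (card V)" using \<open>1 \<le> d\<close> by (intro mult_right_mono) auto
      finally show ?thesis .
    qed
    fix V E assume VE: "(V, E) \<in> sparse_graphs s" "card V < N"
    define r where "r = real (card V)"
    define R where "R = real N"
    have r: "0 \<le> r" "r + 1 \<le> R" using VE(2) by (auto simp: r_def R_def)
    have "2 * real (card E) \<le> r + real s" using total[OF VE(1)] by (simp add: r_def)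
    then have "real (card E) + r \<le> (3 * r + real s) / 2" by simp
    \<comment> \<open>In this form the density of a cone visibly increases with its order
      \<open>r + 1\<close>, since \<open>s < 3\<close>. At order \<open>N\<close> it equals
      \<open>d\<close>.\<close>
    also have "\<dots> = (3 - (3 - real s) / (r + 1)) / 2 * (r + 1)"
      using r(1) by (simp add: field_simps)
    also have "\<dots> \<le> (3 - (3 - real s) / R) / 2 * (r + 1)"
      using r assms(2) by (intro mult_right_mono divide_right_mono diff_left_mono divide_left_mono) auto
    also have "(3 - (3 - real s) / R) / 2 = d"
      by (simp add: R_def N_def d_def field_simps)
    finally show "real (card E) + real (card V) \<le> d * (real (card V) + 1)" by (simp add: r_def)
  qed
  then show ?thesis unfolding d_def by blast
qed

section \<open>Cluster points of higher order\<close>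

text \<open>By \<open>extremal_family_step\<close> the values
  \<open>d' = (d + 1) n / (n + 1)\<close> are again extremal and tend to \<open>d + 1\<close> from
  below. By induction each \<open>d' + i\<close> is a cluster point of order \<open>i\<close>, and
  these accumulate at \<open>d + 1 + i\<close>.\<close>

lemma extremal_cluster_point:
  assumes "extremal_family \<F> d q"
  shows "d + real i \<in> cluster_points i limiting_densities"
  using assms
proof (induction i arbitrary: \<F> d q)
  case 0
  then show ?case using extremal_family_limiting_density by simp
next
  case (Suc i)
  have "d + real (Suc i) islimpt cluster_points i limiting_densities"
    unfolding islimpt_approachable
  proof (intro allI impI)
    fix \<epsilon> :: real assume "0 < \<epsilon>"
    have "0 \<le> d" by (rule extremal_family_nonneg[OF Suc.prems])
    have "0 < q" using Suc.prems by (simp add: extremal_family_def)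
    \<comment> \<open>The first term of the maximum makes \<open>extremal_family_step\<close>
      applicable; the second makes the distance \<open>(d + 1) / (n + 1)\<close> smaller than
      \<open>\<epsilon>\<close>.\<close>
    obtain m :: nat where m: "max d ((d + 1) / \<epsilon>) \<le> real m" using real_arch_simple by blast
    define n where "n = m * q"
    have "m \<le> n" using \<open>0 < q\<close> by (simp add: n_def)
    then have "real m \<le> real n" by simp
    then have n: "d \<le> real n" "(d + 1) / \<epsilon> \<le> real n" using m by auto
    define d' where "d' = (d + 1) * real n / real (n + 1)"
    obtain \<G> where "extremal_family \<G> d' (n + 1)"
      using extremal_family_step[OF Suc.prems, of m] n(1) unfolding n_def d'_def by blast
    then have "d' + real i \<in> cluster_points i limiting_densities" by (rule Suc.IH)
    moreover have diff: "d + 1 - d' = (d + 1) / (real n + 1)" by (simp add: d'_def field_simps)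
    have "0 < (d + 1) / (real n + 1)" using \<open>0 \<le> d\<close> by (simp add: field_simps)
    moreover have "(d + 1) / (real n + 1) < \<epsilon>"
    proof -
      have "d + 1 \<le> real n * \<epsilon>" using n(2) \<open>0 < \<epsilon>\<close> by (simp add: pos_divide_le_eq)
      also have "\<dots> < \<epsilon> * (real n + 1)" using \<open>0 < \<epsilon>\<close> by (simp add: algebra_simps)
      finally show ?thesis by (simp add: pos_divide_less_eq)
    qed
    ultimately show "\<exists>x\<in>cluster_points i limiting_densities.
        x \<noteq> d + real (Suc i) \<and> dist x (d + real (Suc i)) < \<epsilon>"
      using diff by (intro bexI[of _ "d' + real i"]) (auto simp: dist_real_def)
  qed
  then show ?case by simp
qed

section \<open>The densities below 3/2 and the cluster points, assembled from both halves\<close>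

theorem theorem4:
  shows "limiting_densities \<inter> {..<3/2} =
      {real i / (real i + 1) | i :: nat. i \<ge> 0}
    \<union> {3 * real i / (2 * real i + 1) | i :: nat. i \<ge> 1}
    \<union> {(3 * real i + 2) / (2 * real i + 2) | i :: nat. i \<ge> 1}
    \<union> {(3 * real i + 4) / (2 * real i + 3) | i :: nat. i \<ge> 1}
    \<and> (\<forall>i j :: nat. i \<ge> 1 \<longrightarrow> j \<ge> 1 \<longrightarrow>
      real i + (real j - 1) / real j \<in> cluster_points i limiting_densities)"
    (is "_ = ?S \<union> ?A \<union> ?B \<union> ?C \<and> _")
proof (intro conjI allI impI)
  show "limiting_densities \<inter> {..<3/2} = ?S \<union> ?A \<union> ?B \<union> ?C"
  proof (rule equalityI)
    show "limiting_densities \<inter> {..<3/2} \<subseteq> ?S \<union> ?A \<union> ?B \<union> ?C"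
    proof
      fix x assume "x \<in> limiting_densities \<inter> {..<3/2}"
      then obtain \<F> where F: "minor_closed \<F>" "limiting_density \<F> = ereal x" and "x < 3/2"
        by (auto simp: limiting_densities_def)
      show "x \<in> ?S \<union> ?A \<union> ?B \<union> ?C"
      proof (cases "x < 1")
        case True
        then show ?thesis using limiting_density_below_one[OF F] by auto
      next
        case False
        then have "x \<in> triangle_densities"
          using \<open>x < 3/2\<close> by (intro limiting_density_between_one_and_three_halves[OF F]) auto
        then have "x \<in> ?A \<union> ?B \<union> ?C" by (rule subsetD[OF triangle_densities_subset])
        then show ?thesis using UnI2[of x _ ?S] by (simp only: Un_assoc)
      qed
    qed
    have sparse: "(3 * real i + 2 * real s) / (2 * real i + real s + 1) \<in> limiting_densities \<inter> {..<3/2}"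
      if bnd: "1 \<le> i" "s \<le> 2" for i s :: nat
    proof -
      \<comment> \<open>After cross-multiplication this is \<open>s < 3\<close>.\<close>
      have "(3 * real i + 2 * real s) / (2 * real i + real s + 1) < 3/2"
        using bnd(2) by (subst pos_divide_less_eq) auto
      moreover obtain \<F> q where
        "extremal_family \<F> ((3 * real i + 2 * real s) / (2 * real i + real s + 1)) q"
        using extremal_apex_sparse[OF bnd] by blast
      ultimately show ?thesis using extremal_family_limiting_density by simp
    qed
    have "real i / (real i + 1) \<in> limiting_densities \<inter> {..<3/2}" for i :: nat
    proof -
      have "real i / (real i + 1) < 3/2" by (subst pos_divide_less_eq) auto
      moreover obtain \<F> q where "extremal_family \<F> (real i / (real i + 1)) q"
        using extremal_superparticular by blast
      ultimately show ?thesis using extremal_family_limiting_density by simp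
    qed
    then have "?S \<subseteq> limiting_densities \<inter> {..<3/2}" by blast
    moreover have "?A \<subseteq> limiting_densities \<inter> {..<3/2}"
    proof
      fix x assume "x \<in> ?A"
      then obtain i :: nat where "x = 3 * real i / (2 * real i + 1)" "1 \<le> i" by blast
      then show "x \<in> limiting_densities \<inter> {..<3/2}" using sparse[of i 0] by simp
    qed
    moreover have "?B \<subseteq> limiting_densities \<inter> {..<3/2}"
    proof
      fix x assume "x \<in> ?B"
      then obtain i :: nat where "x = (3 * real i + 2) / (2 * real i + 2)" "1 \<le> i" by blast
      then show "x \<in> limiting_densities \<inter> {..<3/2}" using sparse[of i 1] by (simp add: add.commute)
    qed
    moreover have "?C \<subseteq> limiting_densities \<inter> {..<3/2}"
    proof
      fix x assume "x \<in> ?C"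
      then obtain i :: nat where "x = (3 * real i + 4) / (2 * real i + 3)" "1 \<le> i" by blast
      then show "x \<in> limiting_densities \<inter> {..<3/2}" using sparse[of i 2] by (simp add: add.commute)
    qed
    ultimately show "?S \<union> ?A \<union> ?B \<union> ?C \<subseteq> limiting_densities \<inter> {..<3/2}" by (intro Un_least)
  qed
next
  fix i j :: nat assume "1 \<le> i" "1 \<le> j"
  \<comment> \<open>With \<open>j = l + 1\<close> the fractional part \<open>(j - 1) / j\<close> is
    the density \<open>l / (l + 1)\<close>, from which \<open>i\<close> apex steps lead to
    \<open>i + (j - 1) / j\<close>.\<close>
  then obtain l where j: "j = Suc l" by (cases j) auto
  obtain \<F> q where "extremal_family \<F> (real l / (real l + 1)) q"
    using extremal_superparticular by blast
  from extremal_cluster_point[OF this, of i]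
  show "real i + (real j - 1) / real j \<in> cluster_points i limiting_densities"
    by (simp add: j add.commute)
qed

end
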